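(* Let $p\ge3$ be odd, write $p=2q+1$, and let $\ell$ be an integer with $p-1\le\ell\le\min\{n-(p-1),\frac{n}{4(p-1)},\frac{n}{8\log n}\}$. Let $\mathbf{Y}\in(\mathbb{R}^n)^{\otimes p}$ have i.i.d. Rademacher (uniform $\pm1$) entries, and let $\mathbf{M}$ be the $n^\ell\times n^\ell$ matrix defined below. Then for every tensor $\mathbf{Y}$ one has $\|\mathbf{Y}\|_\pm\le n^{1/2}+n^{\ell/2-q}\|\mathbf{M}\|^{1/2}$, and with probability at least $1-n^{-\ell}$ over $\mathbf{Y}$, \[n^{1/2}+n^{\ell/2-q}\|\mathbf{M}\|^{1/2}\le n^{1/2}+8p^p\ell^{1/2-p/4}n^{p/4}(\log n)^{1/4};\] that is, $\|\mathbf{M}\|$ certifies $\|\mathbf{Y}\|_\pm\le n^{1/2}+8p^p\ell^{1/2-p/4}n^{p/4}(\log n)^{1/4}$.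
   Context: Rademacher injective norm: $\|\mathbf{Y}\|_\pm=\max_{x\in\{\pm1\}^n/\sqrt n}|\langle\mathbf{Y},x^{\otimes p}\rangle|$. Index the $p$ coordinates of $\mathbf{Y}$ as $\mathbf{Y}_{ace}$ with $a,c\in[n]^q$, $e\in[n]$. For $a,b,c,d\in[n]^q$ let $\mathbf{T}_{abcd}=\sum_{e\in[n]}\mathbf{Y}_{ace}\mathbf{Y}_{bde}$ and $\tilde{\mathbf{T}}_{abcd}=\mathbf{T}_{abcd}\cdot\mathbf{1}\{ac\ne bd\}$, where $ac$ denotes concatenation of tuples. For tuples $S,T\in[n]^\ell$ and $a,b,c,d\in[n]^q$, write $S\overset{ab,cd}{\longleftrightarrow}T$ if there are distinct indices $i_1,\ldots,i_{2q}\in[\ell]$ such that either (i) $S_{i_j}=(ab)_j$ and $T_{i_j}=(cd)_j$ for all $j\in[2q]$, the values appearing in $a,b,c,d$ do not appear anywhere else in $S$ or $T$, and $S_i=T_i$ for all $i\notin\{i_1,\ldots,i_{2q}\}$; or (ii) the same holds with $ab$ and $cd$ interchanged. Let $N_{ab,cd}$ be the number of pairs $(S,T)$ with $S\overset{ab,cd}{\longleftrightarrow}T$. Then $\mathbf{M}_{S,T}=\sum_{a,b,c,d\in[n]^q}\tilde{\mathbf{T}}_{abcd}N_{ab,cd}^{-1}\mathbf{1}\{S\overset{ab,cd}{\longleftrightarrow}T\}$ for $S,T\in[n]^\ell$. $\|\mathbf{M}\|$ is the operator norm. *)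

theory Defs
  imports "HOL-Probability.Probability"
begin

definition tuples :: "nat \<Rightarrow> nat \<Rightarrow> nat list set" where
  "tuples n k = {xs. length xs = k \<and> set xs \<subseteq> {..<n}}"

definition rad_tensors :: "nat \<Rightarrow> nat \<Rightarrow> (nat list \<Rightarrow> real) set" where
  "rad_tensors n p = PiE (tuples n p) (\<lambda>_. {-1, 1})"

definition rad_inj_norm :: "nat \<Rightarrow> nat \<Rightarrow> (nat list \<Rightarrow> real) \<Rightarrow> real" where
  "rad_inj_norm n p Y =
     Max ((\<lambda>x. \<bar>\<Sum>t\<in>tuples n p. Y t * (\<Prod>i<p. x (t ! i))\<bar>) `
          PiE {..<n} (\<lambda>_. {-1 / sqrt (real n), 1 / sqrt (real n)}))"

definition Tt :: "nat \<Rightarrow> (nat list \<Rightarrow> real) \<Rightarrow> nat list \<Rightarrow> nat list \<Rightarrow> nat list \<Rightarrow> nat list \<Rightarrow> real" where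
  "Tt n Y a b c d = (\<Sum>e<n. Y (a @ c @ [e]) * Y (b @ d @ [e]))"

definition Ttilde :: "nat \<Rightarrow> (nat list \<Rightarrow> real) \<Rightarrow> nat list \<Rightarrow> nat list \<Rightarrow> nat list \<Rightarrow> nat list \<Rightarrow> real" where
  "Ttilde n Y a b c d = (if a @ c \<noteq> b @ d then Tt n Y a b c d else 0)"

definition link_dir :: "nat \<Rightarrow> nat list \<Rightarrow> nat list \<Rightarrow> nat list \<Rightarrow> nat list \<Rightarrow> bool" where
  "link_dir l u v S T \<longleftrightarrow>
     (\<exists>idx. length idx = length u \<and> distinct idx \<and> set idx \<subseteq> {..<l} \<and>
        (\<forall>j<length u. S ! (idx ! j) = u ! j \<and> T ! (idx ! j) = v ! j) \<and>
        (\<forall>i<l. i \<notin> set idx \<longrightarrow>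
            S ! i \<notin> set u \<union> set v \<and> T ! i \<notin> set u \<union> set v \<and> S ! i = T ! i))"

definition linked :: "nat \<Rightarrow> nat list \<Rightarrow> nat list \<Rightarrow> nat list \<Rightarrow> nat list \<Rightarrow> nat list \<Rightarrow> nat list \<Rightarrow> bool" where
  "linked l a b c d S T \<longleftrightarrow> link_dir l (a @ b) (c @ d) S T \<or> link_dir l (c @ d) (a @ b) S T"

definition Ncount :: "nat \<Rightarrow> nat \<Rightarrow> nat list \<Rightarrow> nat list \<Rightarrow> nat list \<Rightarrow> nat list \<Rightarrow> nat" where
  "Ncount n l a b c d = card {(S, T). S \<in> tuples n l \<and> T \<in> tuples n l \<and> linked l a b c d S T}"

definition Mmat :: "nat \<Rightarrow> nat \<Rightarrow> nat \<Rightarrow> (nat list \<Rightarrow> real) \<Rightarrow> nat list \<Rightarrow> nat list \<Rightarrow> real" where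
  "Mmat n q l Y S T =
     (\<Sum>a\<in>tuples n q. \<Sum>b\<in>tuples n q. \<Sum>c\<in>tuples n q. \<Sum>d\<in>tuples n q.
        Ttilde n Y a b c d / real (Ncount n l a b c d) *
        (if linked l a b c d S T then 1 else 0))"

definition op_norm :: "'i set \<Rightarrow> ('i \<Rightarrow> 'i \<Rightarrow> real) \<Rightarrow> real" where
  "op_norm I A = Sup {sqrt (\<Sum>s\<in>I. (\<Sum>t\<in>I. A s t * v t)\<^sup>2) | v. (\<Sum>t\<in>I. (v t)\<^sup>2) \<le> 1}"

end

theory Submission
  imports Defs
begin

text \<open>Certification: Cauchy--Schwarz in the last index \<open>e\<close> gives
  \<open>\<langle>Y, x\<^sup>p\<rangle>\<^sup>2 \<le> n + \<langle>z, M z\<rangle> n\<^sup>l / n\<^sup>2\<^sup>q\<close> with \<open>z\<close> the \<open>l\<close>-th tensor power of \<open>x\<close>, since every linked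
  pair \<open>(S, T)\<close> contributes the same monomial.

  Norm bound: \<open>M\<close> is a chaos of degree two in the signs \<open>Y\<close>, with nonnegative coefficient matrices.
  Instead of counting closed walks in the expansion of \<open>E tr M\<^sup>K\<close>, one follows the Fourier coefficients
  \<open>E (\<Prod>t\<in>P. Y t) (M\<^sup>k)\<^sub>s\<^sub>s\<^sub>'\<close>: multiplying by \<open>M\<close> toggles two elements of \<open>P\<close> sharing the same \<open>e\<close>,
  and the coefficient vanishes if \<open>card P > 2 k\<close>. An explicit supersolution of this recursion, built from double factorials of
  the slice sizes of \<open>P\<close> (as for moments of centred chi-square variables), bounds \<open>E tr M\<^sup>K\<close>.
  Markov's inequality with \<open>K \<approx> 2 l ln n\<close> concludes.\<close>

section \<open>Operator norm and traces\<close>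

text \<open>The target rate is sqrt(n X) with X = l ln n, whereas charging every step for a free
  choice of the shared index e would give n. The gain comes from the signs: a variable that is
  opened has to be closed later, and closing is far more restricted. A variable supplies q of the 2q
  linked entries on each side, so opening it leaves about (l n)^q choices and closing it at most
  (2q)^q; these become \<omega> and \<kappa>. A weight \<sigma> per open variable trades one against
  the other. In a scalar model the sum over e is a centred chi-square variable with n degrees of
  freedom, whose K-th moment norm has order sqrt(K n) + K; the bound l \<le> n / (8 ln n) keeps the
  first term dominant. Closed walks would have to be classified by the recurrence pattern of their
  variables, while the Fourier recursion remembers only the set of open variables. The factor n^l
  from the trace is absorbed by the choice of K at the price of a constant.\<close>

primrec mat_pow :: "'i set \<Rightarrow> ('i \<Rightarrow> 'i \<Rightarrow> real) \<Rightarrow> nat \<Rightarrow> 'i \<Rightarrow> 'i \<Rightarrow> real" where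
  "mat_pow I A 0 = (\<lambda>s t. if s = t then 1 else 0)"
| "mat_pow I A (Suc k) = (\<lambda>s t. \<Sum>r\<in>I. A s r * mat_pow I A k r t)"

lemma mat_pow_add:
  assumes "finite I" "s \<in> I"
  shows "mat_pow I A (j + k) s t = (\<Sum>r\<in>I. mat_pow I A j s r * mat_pow I A k r t)"
  using assms(2)
proof (induction j arbitrary: s)
  case 0
  have "(\<Sum>r\<in>I. (if s = r then 1 else 0) * mat_pow I A k r t)
      = (\<Sum>r\<in>I. if s = r then mat_pow I A k r t else 0)"
    by (intro sum.cong) auto
  with 0 assms(1) show ?case by simp
next
  case (Suc j)
  have "mat_pow I A (Suc j + k) s t
      = (\<Sum>r\<in>I. A s r * (\<Sum>r'\<in>I. mat_pow I A j r r' * mat_pow I A k r' t))"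
    using Suc.IH by (auto intro!: sum.cong)
  also have "\<dots> = (\<Sum>r'\<in>I. \<Sum>r\<in>I. A s r * mat_pow I A j r r' * mat_pow I A k r' t)"
    by (subst sum.swap) (simp add: sum_distrib_left mult.assoc)
  finally show ?case by (simp add: sum_distrib_right)
qed

lemma mat_pow_sym:
  assumes "finite I" and sym: "\<And>s t. s \<in> I \<Longrightarrow> t \<in> I \<Longrightarrow> A s t = A t s"
    and "s \<in> I" "t \<in> I"
  shows "mat_pow I A k s t = mat_pow I A k t s"
  using assms(3,4)
proof (induction k arbitrary: s t)
  case (Suc k)
  have one: "mat_pow I A (Suc 0) r t = A r t" if "r \<in> I" for r
  proof -
    have "(\<Sum>r'\<in>I. A r r' * (if r' = t then 1 else 0)) = (\<Sum>r'\<in>I. if r' = t then A r r' else 0)"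
      by (intro sum.cong) auto
    with assms(1) Suc.prems show ?thesis by simp
  qed
  have "mat_pow I A (Suc k) s t = (\<Sum>r\<in>I. mat_pow I A k s r * A r t)"
    using mat_pow_add[OF assms(1) Suc.prems(1), of A k "Suc 0" t] one by simp
  also have "\<dots> = (\<Sum>r\<in>I. A t r * mat_pow I A k r s)"
    using Suc sym by (intro sum.cong) (auto simp: mult.commute)
  finally show ?case by simp
qed auto

section \<open>Norms of iterates of a symmetric matrix\<close>

definition mat_vec :: "'i set \<Rightarrow> ('i \<Rightarrow> 'i \<Rightarrow> real) \<Rightarrow> ('i \<Rightarrow> real) \<Rightarrow> 'i \<Rightarrow> real" where
  "mat_vec I A v s = (\<Sum>t\<in>I. A s t * v t)"

lemma mat_vec_norm_le:
  "(\<Sum>s\<in>I. (mat_vec I A v s)\<^sup>2) \<le> (\<Sum>s\<in>I. \<Sum>t\<in>I. (A s t)\<^sup>2) * (\<Sum>t\<in>I. (v t)\<^sup>2)"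
  unfolding mat_vec_def sum_distrib_right
  by (intro sum_mono) (simp add: Cauchy_Schwarz_ineq_sum flip: sum_distrib_right)

lemma mat_vec_adjoint:
  assumes "\<And>s t. s \<in> I \<Longrightarrow> t \<in> I \<Longrightarrow> A s t = A t s"
  shows "(\<Sum>s\<in>I. mat_vec I A v s * w s) = (\<Sum>s\<in>I. v s * mat_vec I A w s)"
proof -
  have "(\<Sum>s\<in>I. mat_vec I A v s * w s) = (\<Sum>s\<in>I. \<Sum>t\<in>I. A s t * v t * w s)"
    by (simp add: mat_vec_def sum_distrib_right)
  also have "\<dots> = (\<Sum>t\<in>I. \<Sum>s\<in>I. A s t * v t * w s)"
    by (rule sum.swap)
  also have "\<dots> = (\<Sum>t\<in>I. \<Sum>s\<in>I. v t * (A t s * w s))"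
    using assms by (intro sum.cong) auto
  finally show ?thesis by (simp add: mat_vec_def sum_distrib_left)
qed

lemma mat_vec_funpow:
  assumes "finite I" "s \<in> I"
  shows "(mat_vec I A ^^ k) v s = mat_vec I (mat_pow I A k) v s"
  using assms(2)
proof (induction k arbitrary: s)
  case 0
  have "(\<Sum>t\<in>I. (if s = t then 1 else 0) * v t) = (\<Sum>t\<in>I. if s = t then v t else 0)"
    by (intro sum.cong) auto
  with assms(1) 0 show ?case by (simp add: mat_vec_def)
next
  case (Suc k)
  have "(mat_vec I A ^^ Suc k) v s = (\<Sum>r\<in>I. A s r * (\<Sum>t\<in>I. mat_pow I A k r t * v t))"
    by (simp add: mat_vec_def[of I A "(mat_vec I A ^^ k) v"] Suc.IH)
      (simp add: mat_vec_def)
  also have "\<dots> = (\<Sum>t\<in>I. \<Sum>r\<in>I. A s r * mat_pow I A k r t * v t)"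
    by (subst sum.swap) (simp add: sum_distrib_left mult.assoc)
  finally show ?case
    by (subst mat_vec_def[of I "mat_pow I A (Suc k)"]) (simp add: sum_distrib_right)
qed

text \<open>For symmetric \<open>A\<close> the squared norms \<open>m j\<close> of \<open>A\<^sup>j v\<close> form a log-convex sequence by the
  Cauchy--Schwarz inequality; this replaces the spectral theorem.\<close>

lemma mat_vec_norm_power_le_trace:
  assumes fin: "finite I" and sym: "\<And>s t. s \<in> I \<Longrightarrow> t \<in> I \<Longrightarrow> A s t = A t s"
    and v: "(\<Sum>t\<in>I. (v t)\<^sup>2) \<le> 1" and k: "k > 0"
  shows "(\<Sum>s\<in>I. (mat_vec I A v s)\<^sup>2) ^ k \<le> (\<Sum>s\<in>I. mat_pow I A (2 * k) s s)"
proof -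
  define w where "w j = (mat_vec I A ^^ j) v" for j
  define m where "m j = (\<Sum>s\<in>I. (w j s)\<^sup>2)" for j
  have m_nonneg: "m j \<ge> 0" for j by (simp add: m_def sum_nonneg)
  have m_conv: "(m (Suc j))\<^sup>2 \<le> m j * m (Suc (Suc j))" for j
  proof -
    have "m (Suc j) = (\<Sum>s\<in>I. mat_vec I A (w j) s * w (Suc j) s)"
      by (simp add: m_def w_def power2_eq_square)
    also have "\<dots> = (\<Sum>s\<in>I. w j s * w (Suc (Suc j)) s)"
      by (subst mat_vec_adjoint[OF sym]) (auto simp: w_def)
    finally show ?thesis by (simp add: m_def Cauchy_Schwarz_ineq_sum)
  qed
  have m0: "m 0 \<le> 1" using v by (simp add: m_def w_def)
  \<comment> \<open>By log-convexity the ratios of consecutive terms increase, and the first is at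
    least \<open>m 1\<close> because \<open>m 0\<close> is at most 1. The product form also makes
    sense when \<open>m j\<close> vanishes.\<close>
  have ratio: "m 1 * m j \<le> m (Suc j)" for j
  proof (induction j)
    case 0
    show ?case using mult_left_le[OF m0 m_nonneg[of 1]] by simp
  next
    case (Suc j)
    show ?case
    proof (cases "m j = 0")
      case True
      with m_conv[of j] show ?thesis using m_nonneg[of "Suc (Suc j)"] by simp
    next
      case False
      then have pos: "m j > 0" using m_nonneg[of j] by simp
      have "m 1 * m j * m (Suc j) \<le> m (Suc j) * m (Suc j)"
        using Suc m_nonneg by (intro mult_right_mono)
      also have "\<dots> \<le> m j * m (Suc (Suc j))"
        using m_conv[of j] by (simp add: power2_eq_square)
      finally have "m j * (m 1 * m (Suc j)) \<le> m j * m (Suc (Suc j))"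
        by (simp add: mult_ac)
      with pos show ?thesis by simp
    qed
  qed
  have step: "m 1 ^ k \<le> m k" if "k > 0"
    using that
  proof (induction k rule: nat_induct_non_zero)
    case (Suc k)
    have "m 1 ^ Suc k \<le> m 1 * m k"
      using Suc m_nonneg by (auto intro: mult_left_mono)
    with ratio[of k] show ?case by simp
  qed simp
  \<comment> \<open>By symmetry the diagonal entries of A^(2k) are the squared row norms of A^k, so
    the trace is a squared Frobenius norm.\<close>
  have frob: "(\<Sum>s\<in>I. \<Sum>t\<in>I. (mat_pow I A k s t)\<^sup>2) = (\<Sum>s\<in>I. mat_pow I A (2 * k) s s)"
    using mat_pow_add[OF fin, of _ A k k] mat_pow_sym[OF fin sym]
    by (auto simp: mult_2 power2_eq_square intro!: sum.cong)
  have "m k \<le> (\<Sum>s\<in>I. \<Sum>t\<in>I. (mat_pow I A k s t)\<^sup>2) * (\<Sum>t\<in>I. (v t)\<^sup>2)"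
      using mat_vec_norm_le[of I "mat_pow I A k" v]
    by (simp add: m_def w_def mat_vec_funpow[OF fin])
  also have "\<dots> \<le> (\<Sum>s\<in>I. \<Sum>t\<in>I. (mat_pow I A k s t)\<^sup>2)"
      using v by (intro mult_left_le sum_nonneg) auto
  finally show ?thesis using step[OF k] frob by (simp add: m_def w_def)
qed


text \<open>A real supremum is informative only on a bounded set; the Frobenius norm supplies the
  bound.\<close>

lemma op_norm_bdd_above:
  "bdd_above {sqrt (\<Sum>s\<in>I. (\<Sum>t\<in>I. A s t * v t)\<^sup>2) | v. (\<Sum>t\<in>I. (v t)\<^sup>2) \<le> 1}"
proof (rule bdd_aboveI)
  fix z assume "z \<in> {sqrt (\<Sum>s\<in>I. (\<Sum>t\<in>I. A s t * v t)\<^sup>2) | v. (\<Sum>t\<in>I. (v t)\<^sup>2) \<le> 1}"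
  then obtain v where z: "z = sqrt (\<Sum>s\<in>I. (mat_vec I A v s)\<^sup>2)"
    and v: "(\<Sum>t\<in>I. (v t)\<^sup>2) \<le> 1"
    by (auto simp: mat_vec_def)
  have "(\<Sum>s\<in>I. \<Sum>t\<in>I. (A s t)\<^sup>2) * (\<Sum>t\<in>I. (v t)\<^sup>2) \<le> (\<Sum>s\<in>I. \<Sum>t\<in>I. (A s t)\<^sup>2)"
    using v by (intro mult_left_le sum_nonneg) auto
  with mat_vec_norm_le[of I A v] show "z \<le> sqrt (\<Sum>s\<in>I. \<Sum>t\<in>I. (A s t)\<^sup>2)"
    unfolding z by (intro real_sqrt_le_mono) linarith
qed

lemma mat_vec_norm_le_op_norm:
  assumes "(\<Sum>t\<in>I. (v t)\<^sup>2) \<le> 1"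
  shows "sqrt (\<Sum>s\<in>I. (mat_vec I A v s)\<^sup>2) \<le> op_norm I A"
  unfolding op_norm_def mat_vec_def
  by (rule cSup_upper[OF _ op_norm_bdd_above]) (use assms in blast)

lemma op_norm_nonneg: "op_norm I A \<ge> 0"
  using mat_vec_norm_le_op_norm[where v = "\<lambda>_. 0" and I = I and A = A] by (simp add: mat_vec_def)

lemma quadratic_form_le_op_norm:
  assumes "(\<Sum>t\<in>I. (v t)\<^sup>2) \<le> 1"
  shows "(\<Sum>s\<in>I. \<Sum>t\<in>I. A s t * v s * v t) \<le> op_norm I A"
proof -
  have "(\<Sum>s\<in>I. \<Sum>t\<in>I. A s t * v s * v t) = (\<Sum>s\<in>I. v s * mat_vec I A v s)"
    by (simp add: mat_vec_def sum_distrib_left mult_ac)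
  also have "\<dots> \<le> sqrt ((\<Sum>s\<in>I. (v s)\<^sup>2) * (\<Sum>s\<in>I. (mat_vec I A v s)\<^sup>2))"
    by (rule real_le_rsqrt) (rule Cauchy_Schwarz_ineq_sum)
  also have "\<dots> \<le> sqrt (\<Sum>s\<in>I. (mat_vec I A v s)\<^sup>2)"
    using assms by (intro real_sqrt_le_mono mult_left_le_one_le sum_nonneg) auto
  finally show ?thesis using mat_vec_norm_le_op_norm[OF assms] by (rule order_trans)
qed

text \<open>The trace of an even power dominates the growth of every vector of norm at most one, so
  no eigenvalues are needed. This is the deterministic half of the moment method.\<close>

lemma op_norm_le_of_trace:
  assumes "finite I" and sym: "\<And>s t. s \<in> I \<Longrightarrow> t \<in> I \<Longrightarrow> A s t = A t s"
    and k: "k > 0" and \<tau>: "\<tau> \<ge> 0" and tr: "(\<Sum>s\<in>I. mat_pow I A (2 * k) s s) \<le> \<tau> ^ (2 * k)"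
  shows "op_norm I A \<le> \<tau>"
  unfolding op_norm_def
proof (rule cSup_least)
  show "{sqrt (\<Sum>s\<in>I. (\<Sum>t\<in>I. A s t * v t)\<^sup>2) | v. (\<Sum>t\<in>I. (v t)\<^sup>2) \<le> 1} \<noteq> {}"
    by (auto intro!: exI[of _ "\<lambda>_. 0"])
next
  fix z assume "z \<in> {sqrt (\<Sum>s\<in>I. (\<Sum>t\<in>I. A s t * v t)\<^sup>2) | v. (\<Sum>t\<in>I. (v t)\<^sup>2) \<le> 1}"
  then obtain v where z: "z = sqrt (\<Sum>s\<in>I. (mat_vec I A v s)\<^sup>2)"
    and v: "(\<Sum>t\<in>I. (v t)\<^sup>2) \<le> 1"
    by (auto simp: mat_vec_def)
  have "(\<Sum>s\<in>I. (mat_vec I A v s)\<^sup>2) ^ k \<le> (\<tau>\<^sup>2) ^ k"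
    using order_trans[OF mat_vec_norm_power_le_trace[OF assms(1) sym v k] tr] by (simp add: power_mult)
  then have "(\<Sum>s\<in>I. (mat_vec I A v s)\<^sup>2) \<le> \<tau>\<^sup>2"
    using k power_mono_iff[of _ "\<tau>\<^sup>2" k] by (simp add: sum_nonneg)
  then show "z \<le> \<tau>"
    using \<tau> unfolding z by (intro real_le_lsqrt)
qed

section \<open>Matrix chaos with paired colours\<close>

text \<open>Symmetric difference with a singleton. Since signs square to one, monomials in them are
  indexed by sets, and multiplication by one more variable acts on the set in this way.\<close>

definition toggle :: "'a \<Rightarrow> 'a set \<Rightarrow> 'a set" where
  "toggle x P = (if x \<in> P then P - {x} else insert x P)"

lemma toggle_subset: "x \<in> V \<Longrightarrow> P \<subseteq> V \<Longrightarrow> toggle x P \<subseteq> V"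
  by (auto simp: toggle_def)

lemma card_le_Suc_card_toggle: "card P \<le> Suc (card (toggle x P))"
  by (cases "finite P") (auto simp: toggle_def card_Diff_singleton_if card_insert_if)

lemma prod_toggle:
  assumes "finite P" "Y x = -1 \<or> Y x = (1::real)"
  shows "(\<Prod>t\<in>toggle x P. Y t) = Y x * (\<Prod>t\<in>P. Y t)"
proof (cases "x \<in> P")
  case True
  have "Y x * Y x = 1" using assms(2) by auto
  moreover have "(\<Prod>t\<in>P. Y t) = Y x * (\<Prod>t\<in>P - {x}. Y t)"
    using assms(1) True by (rule prod.remove)
  ultimately show ?thesis using True by (simp add: toggle_def flip: mult.assoc)
qed (use assms in \<open>simp add: toggle_def\<close>)

section \<open>Characters of the sign cube\<close>

definition sign_vectors :: "'v set \<Rightarrow> ('v \<Rightarrow> real) set" where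
  "sign_vectors V = PiE V (\<lambda>_. {-1, 1})"

lemma finite_sign_vectors: "finite V \<Longrightarrow> finite (sign_vectors V)"
  by (simp add: sign_vectors_def finite_PiE)

lemma sign_vectors_cases: "Y \<in> sign_vectors V \<Longrightarrow> t \<in> V \<Longrightarrow> Y t = -1 \<or> Y t = 1"
  by (auto simp: sign_vectors_def dest: PiE_mem)

text \<open>The sum factorises over the coordinates, and a coordinate in \<open>P\<close>
  contributes -1 + 1 = 0.\<close>

lemma sum_sign_vectors_prod:
  assumes "finite V" "P \<subseteq> V" "P \<noteq> {}"
  shows "(\<Sum>Y\<in>sign_vectors V. \<Prod>t\<in>P. Y t) = (0::real)"
proof -
  have "(\<Sum>Y\<in>sign_vectors V. \<Prod>t\<in>P. Y t)
      = (\<Sum>Y\<in>sign_vectors V. \<Prod>t\<in>V. if t \<in> P then Y t else 1)"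
    using assms by (simp add: prod.If_cases Int_absorb1)
  also have "\<dots> = (\<Prod>t\<in>V. \<Sum>z\<in>{-1, 1}. if t \<in> P then z else 1)"
    unfolding sign_vectors_def using assms(1) by (subst prod_sum_PiE) auto
  also have "\<dots> = 0"
    using assms by (intro prod_zero) auto
  finally show ?thesis .
qed

text \<open>\<open>dfact (j + 1)\<close> is the double factorial \<open>j!!\<close>.\<close>

fun dfact :: "nat \<Rightarrow> real" where
  "dfact 0 = 1"
| "dfact (Suc 0) = 1"
| "dfact (Suc (Suc j)) = real (Suc j) * dfact j"

lemma dfact_pos: "dfact j > 0"
  by (induction j rule: dfact.induct) auto

text \<open>A matrix-valued homogeneous chaos of degree two whose two factors in every term carry the same
  colour. In a step of the trace expansion a factor either opens a new
  variable (at cost \<open>\<omega>\<close>) or closes an open one (at cost \<open>\<kappa>\<close>).\<close>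

locale paired_chaos =
  fixes V :: "'v set" and col :: "'v \<Rightarrow> 'c" and C :: "'c set"
    and J :: "'j set" and x y :: "'j \<Rightarrow> 'v"
    and B :: "'j \<Rightarrow> 'i \<Rightarrow> 'i \<Rightarrow> real" and I :: "'i set" and D \<omega> \<kappa> :: real
  assumes finite_V: "finite V" and finite_C: "finite C" and finite_J: "finite J" and finite_I: "finite I"
    and x_in: "j \<in> J \<Longrightarrow> x j \<in> V" and y_in: "j \<in> J \<Longrightarrow> y j \<in> V" and x_neq_y: "j \<in> J \<Longrightarrow> x j \<noteq> y j"
    and col_in: "j \<in> J \<Longrightarrow> col (x j) \<in> C" and col_eq: "j \<in> J \<Longrightarrow> col (y j) = col (x j)"
    and B_nonneg: "j \<in> J \<Longrightarrow> s \<in> I \<Longrightarrow> t \<in> I \<Longrightarrow> B j s t \<ge> 0"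
    and D_nonneg: "D \<ge> 0" and \<omega>_pos: "\<omega> > 0" and \<kappa>_pos: "\<kappa> > 0"
    and open_open: "s \<in> I \<Longrightarrow> e \<in> C \<Longrightarrow>
      (\<Sum>j | j \<in> J \<and> col (x j) = e. \<Sum>t\<in>I. B j s t) \<le> D * \<omega>\<^sup>2"
    and close_open: "s \<in> I \<Longrightarrow> v \<in> V \<Longrightarrow>
      (\<Sum>j | j \<in> J \<and> x j = v. \<Sum>t\<in>I. B j s t) \<le> D * (\<omega> * \<kappa>)"
    and open_close: "s \<in> I \<Longrightarrow> v \<in> V \<Longrightarrow>
      (\<Sum>j | j \<in> J \<and> y j = v. \<Sum>t\<in>I. B j s t) \<le> D * (\<omega> * \<kappa>)"
    and close_close: "s \<in> I \<Longrightarrow> v \<in> V \<Longrightarrow> v' \<in> V \<Longrightarrow>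
      (\<Sum>j | j \<in> J \<and> x j = v \<and> y j = v'. \<Sum>t\<in>I. B j s t) \<le> D * \<kappa>\<^sup>2"
begin

definition chaos :: "('v \<Rightarrow> real) \<Rightarrow> 'i \<Rightarrow> 'i \<Rightarrow> real" where
  "chaos Y s t = (\<Sum>j\<in>J. Y (x j) * Y (y j) * B j s t)"

text \<open>The unnormalised Fourier coefficient at \<open>P\<close> of an entry of the \<open>k\<close>-th power.\<close>

definition coeff :: "'i \<Rightarrow> nat \<Rightarrow> 'i \<Rightarrow> 'v set \<Rightarrow> real" where
  "coeff s\<^sub>0 k s P = (\<Sum>Y\<in>sign_vectors V. (\<Prod>t\<in>P. Y t) * mat_pow I (chaos Y) k s s\<^sub>0)"

text \<open>The first matrix factor is expanded, and its two signs are absorbed into the character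
  of \<open>P\<close>, which toggles both variables. The rest is interchange of finite sums.\<close>

lemma coeff_Suc:
  assumes "P \<subseteq> V"
  shows "coeff s\<^sub>0 (Suc k) s P
       = (\<Sum>j\<in>J. \<Sum>t\<in>I. B j s t * coeff s\<^sub>0 k t (toggle (x j) (toggle (y j) P)))"
proof -
  have finP: "finite P" using assms finite_V finite_subset by blast
  have prod: "(\<Prod>t\<in>toggle (x j) (toggle (y j) P). Y t) = Y (x j) * Y (y j) * (\<Prod>t\<in>P. Y t)"
    if "j \<in> J" "Y \<in> sign_vectors V" for j Y
    using that finP sign_vectors_cases[OF that(2)] x_in y_in
    by (subst prod_toggle prod_toggle; (simp add: prod_toggle)?) (auto simp: toggle_def prod_toggle)
  have "coeff s\<^sub>0 (Suc k) s P
      = (\<Sum>Y\<in>sign_vectors V. \<Sum>t\<in>I. \<Sum>j\<in>J.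
          B j s t * ((\<Prod>t\<in>toggle (x j) (toggle (y j) P). Y t) * mat_pow I (chaos Y) k t s\<^sub>0))"
    unfolding coeff_def
    by (intro sum.cong refl)
      (simp add: chaos_def sum_distrib_left sum_distrib_right prod mult_ac)
  also have "\<dots> = (\<Sum>j\<in>J. \<Sum>t\<in>I. \<Sum>Y\<in>sign_vectors V.
          B j s t * ((\<Prod>t\<in>toggle (x j) (toggle (y j) P). Y t) * mat_pow I (chaos Y) k t s\<^sub>0))"
    by (subst sum.swap, subst (2) sum.swap, subst sum.swap) (rule refl)
  finally show ?thesis by (simp add: coeff_def sum_distrib_left)
qed

text \<open>A degree argument: each multiplication by the chaos removes at most two elements of the
  set, so a larger set is not exhausted and its character averages to zero.\<close>

lemma coeff_eq_0:
  assumes "P \<subseteq> V" "card P > 2 * k"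
  shows "coeff s\<^sub>0 k s P = 0"
  using assms
proof (induction k arbitrary: s P)
  case 0
  then have "P \<noteq> {}" by auto
  then show ?case
    using sum_sign_vectors_prod[OF finite_V 0(1)]
    by (simp add: coeff_def flip: sum_distrib_right)
next
  case (Suc k)
  have "coeff s\<^sub>0 k t (toggle (x j) (toggle (y j) P)) = 0" if "j \<in> J" for j t
  proof (rule Suc.IH)
    show "toggle (x j) (toggle (y j) P) \<subseteq> V"
      using that Suc.prems x_in y_in by (intro toggle_subset)
    show "2 * k < card (toggle (x j) (toggle (y j) P))"
      using card_le_Suc_card_toggle[of P "y j"]
        card_le_Suc_card_toggle[of "toggle (y j) P" "x j"] Suc.prems by simp
  qed
  then show ?case by (simp add: coeff_Suc[OF Suc.prems(1)])
qed

section \<open>The supersolution of the recursion\<close>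

definition slice :: "'v set \<Rightarrow> 'c \<Rightarrow> 'v set" where
  "slice P e = {v\<in>P. col v = e}"

text \<open>The double factorials make the costs of opening and of closing two variables of a colour both
  linear in the number of open variables of that colour.\<close>

definition pot :: "real \<Rightarrow> 'v set \<Rightarrow> real" where
  "pot \<sigma> P = \<sigma> ^ card P * (\<Prod>e\<in>C. dfact (card (slice P e)))"

lemma pot_nonneg: "\<sigma> \<ge> 0 \<Longrightarrow> pot \<sigma> P \<ge> 0"
  by (simp add: pot_def prod_nonneg dfact_pos less_imp_le)

text \<open>Two new variables of a colour with r open ones advance the double factorial by one step,
  hence the factor r + 1. Read backwards, closing two out of r divides by
  \<open>\<sigma>\<^sup>2\<close> and by r - 1.\<close>

lemma pot_insert2:
  assumes "finite P" "u \<notin> P" "v \<notin> P" "u \<noteq> v" "col u = e" "col v = e" "e \<in> C"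
  shows "pot \<sigma> (insert u (insert v P)) = \<sigma>\<^sup>2 * real (Suc (card (slice P e))) * pot \<sigma> P"
proof -
  let ?P = "insert u (insert v P)"
  have eq: "slice ?P e' = slice P e'" if "e' \<noteq> e" for e'
    using that assms by (auto simp: slice_def)
  have "slice ?P e = insert u (insert v (slice P e))"
    using assms by (auto simp: slice_def)
  then have card: "card (slice ?P e) = Suc (Suc (card (slice P e)))"
    using assms by (simp add: slice_def)
  have "(\<Prod>e\<in>C. dfact (card (slice ?P e)))
      = dfact (card (slice ?P e)) * (\<Prod>e\<in>C - {e}. dfact (card (slice ?P e)))"
    using finite_C assms by (intro prod.remove)
  also have "\<dots> = real (Suc (card (slice P e))) * (dfact (card (slice P e)) * (\<Prod>e\<in>C - {e}. dfact (card (slice P e))))"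
    by (simp add: card eq)
  also have "\<dots> = real (Suc (card (slice P e))) * (\<Prod>e\<in>C. dfact (card (slice P e)))"
    using prod.remove[OF finite_C \<open>e \<in> C\<close>, of "\<lambda>e. dfact (card (slice P e))"] by simp
  finally show ?thesis
    using assms by (simp add: pot_def power2_eq_square mult_ac)
qed

text \<open>The potential depends only on slice sizes, and these survive the replacement of a
  variable by another of its colour. Hence closing one variable while opening its partner leaves the
  potential unchanged.\<close>

lemma pot_exchange:
  assumes "finite P" "u \<in> P" "v \<notin> P" "col u = col v"
  shows "pot \<sigma> (insert v (P - {u})) = pot \<sigma> P"
proof -
  have "card (slice (insert v (P - {u})) e) = card (slice P e)" for e
  proof (cases "col u = e")
    case True
    then have "slice (insert v (P - {u})) e = insert v (slice P e - {u})"
      using assms by (auto simp: slice_def)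
    moreover have "card (insert v (slice P e - {u})) = Suc (card (slice P e - {u}))"
      using assms by (simp add: slice_def)
    moreover have "\<dots> = card (slice P e)"
      using True assms by (intro card_Suc_Diff1) (auto simp: slice_def)
    ultimately show ?thesis by simp
  next
    case False
    then have "slice (insert v (P - {u})) e = slice P e"
      using assms by (auto simp: slice_def)
    then show ?thesis by simp
  qed
  moreover have "card (insert v (P - {u})) = card P"
    using card_Suc_Diff1[OF assms(1,2)] assms by simp
  ultimately show ?thesis by (simp add: pot_def)
qed

text \<open>The terms of colour \<open>e\<close> are split by which of their two variables are open.
  With none open, the potential grows by r + 1. With one open, there are r choices for it, in either
  role, at unchanged potential. With both open, there are r (r - 1) ordered pairs, but the potential
  drops by r - 1. Every case is therefore affine in r, so that the bounds can be summed over colours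
  knowing only the total number of open variables.\<close>

lemma sum_pot_le:
  assumes P: "P \<subseteq> V" and s: "s \<in> I" and e: "e \<in> C" and \<sigma>: "\<sigma> > 0"
  defines "r \<equiv> real (card (slice P e))"
  shows "(\<Sum>j | j \<in> J \<and> col (x j) = e. (\<Sum>t\<in>I. B j s t) * pot \<sigma> (toggle (x j) (toggle (y j) P)))
       \<le> D * pot \<sigma> P * (\<omega>\<^sup>2 * \<sigma>\<^sup>2 * (r + 1) + 2 * \<omega> * \<kappa> * r + \<kappa>\<^sup>2 * r / \<sigma>\<^sup>2)"
    (is "?lhs \<le> _")
proof -
  define b where "b j = (\<Sum>t\<in>I. B j s t)" for j
  have b: "b j \<ge> 0" if "j \<in> J" for j
    unfolding b_def using that s B_nonneg by (intro sum_nonneg)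
  have finP: "finite P" using P finite_V finite_subset by blast
  have finS: "finite (slice P e)" using finP by (simp add: slice_def)
  define Je where "Je = {j\<in>J. col (x j) = e}"
  have finJe: "finite Je" using finite_J by (simp add: Je_def)
  define f where "f j = b j * pot \<sigma> (toggle (x j) (toggle (y j) P))" for j
  have f: "f j \<ge> 0" if "j \<in> J" for j
    unfolding f_def using that b \<sigma> by (intro mult_nonneg_nonneg pot_nonneg) auto
  define J00 where "J00 = {j\<in>Je. x j \<notin> P \<and> y j \<notin> P}"
  define J10 where "J10 = {j\<in>Je. x j \<in> P \<and> y j \<notin> P}"
  define J01 where "J01 = {j\<in>Je. x j \<notin> P \<and> y j \<in> P}"
  define J11 where "J11 = {j\<in>Je. x j \<in> P \<and> y j \<in> P}"
  note defs = Je_def J00_def J10_def J01_def J11_def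
  have split: "?lhs = sum f J00 + sum f J10 + sum f J01 + sum f J11"
  proof -
    have "?lhs = sum f Je" by (simp add: f_def b_def Je_def)
    also have "Je = J00 \<union> J10 \<union> J01 \<union> J11" by (auto simp: defs)
    also have "sum f \<dots> = sum f J00 + sum f J10 + sum f J01 + sum f J11"
      using finJe unfolding J00_def J10_def J01_def J11_def
      by (subst sum.union_disjoint; (auto)?)+
    finally show ?thesis .
  qed
  have p0: "pot \<sigma> P \<ge> 0" using \<sigma> by (intro pot_nonneg) simp
  have b00: "sum f J00 \<le> \<sigma>\<^sup>2 * (r + 1) * pot \<sigma> P * (D * \<omega>\<^sup>2)"
  proof -
    have "f j = \<sigma>\<^sup>2 * (r + 1) * pot \<sigma> P * b j" if "j \<in> J00" for j
      using that x_neq_y[of j] col_eq[of j] pot_insert2[of P "x j" "y j" e \<sigma>] finP e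
      by (simp add: f_def defs toggle_def r_def)
    then have "sum f J00 = \<sigma>\<^sup>2 * (r + 1) * pot \<sigma> P * sum b J00"
      by (simp add: sum_distrib_left)
    also have "\<dots> \<le> \<sigma>\<^sup>2 * (r + 1) * pot \<sigma> P * sum b Je"
      using finJe b p0 by (intro mult_left_mono sum_mono2) (auto simp: defs r_def)
    also have "\<dots> \<le> \<sigma>\<^sup>2 * (r + 1) * pot \<sigma> P * (D * \<omega>\<^sup>2)"
      using open_open[OF s e] p0 by (intro mult_left_mono) (auto simp: b_def Je_def r_def)
    finally show ?thesis .
  qed
  have b10: "sum f J10 \<le> r * (D * (\<omega> * \<kappa>)) * pot \<sigma> P"
  proof -
    have "f j = pot \<sigma> P * b j" if "j \<in> J10" for j
      using that x_neq_y[of j] col_eq[of j] pot_exchange[of P "x j" "y j" \<sigma>] finP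
      by (auto simp: f_def defs toggle_def insert_Diff_if)
    then have "sum f J10 = sum b J10 * pot \<sigma> P"
      by (simp add: mult.commute sum_distrib_right)
    also have "sum b J10 \<le> sum b (\<Union>v\<in>slice P e. {j\<in>J. x j = v})"
      using finite_J finS b by (intro sum_mono2) (auto simp: defs slice_def)
    also have "\<dots> \<le> (\<Sum>v\<in>slice P e. sum b {j\<in>J. x j = v})"
      using finite_J finS by (subst sum.UNION_disjoint) auto
    also have "\<dots> \<le> (\<Sum>v\<in>slice P e. D * (\<omega> * \<kappa>))"
      using close_open[OF s] P by (intro sum_mono) (auto simp: b_def slice_def)
    finally show ?thesis using p0 by (simp add: r_def mult_right_mono)
  qed
  have b01: "sum f J01 \<le> r * (D * (\<omega> * \<kappa>)) * pot \<sigma> P"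
  proof -
    have "f j = pot \<sigma> P * b j" if "j \<in> J01" for j
      using that x_neq_y[of j] col_eq[of j] pot_exchange[of P "y j" "x j" \<sigma>] finP
      by (auto simp: f_def defs toggle_def)
    then have "sum f J01 = sum b J01 * pot \<sigma> P"
      by (simp add: mult.commute sum_distrib_right)
    also have "sum b J01 \<le> sum b (\<Union>v\<in>slice P e. {j\<in>J. y j = v})"
      using finite_J finS b col_eq by (intro sum_mono2) (auto simp: defs slice_def)
    also have "\<dots> \<le> (\<Sum>v\<in>slice P e. sum b {j\<in>J. y j = v})"
      using finite_J finS by (subst sum.UNION_disjoint) auto
    also have "\<dots> \<le> (\<Sum>v\<in>slice P e. D * (\<omega> * \<kappa>))"
      using open_close[OF s] P by (intro sum_mono) (auto simp: b_def slice_def)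
    finally show ?thesis using p0 by (simp add: r_def mult_right_mono)
  qed
  have b11: "sum f J11 \<le> r * (D * \<kappa>\<^sup>2) * (pot \<sigma> P / \<sigma>\<^sup>2)"
  \<comment> \<open>Both variables are distinct elements of the slice, so fewer than two elements
    leave no term; otherwise r - 1 is positive and may be divided by.\<close>
  proof (cases "card (slice P e) \<ge> 2")
    case False
    have "J11 = {}"
    proof (rule ccontr)
      assume "J11 \<noteq> {}"
      then obtain j where "j \<in> J11" by blast
      then have "{x j, y j} \<subseteq> slice P e" "x j \<noteq> y j"
        using x_neq_y[of j] col_eq[of j] by (auto simp: defs slice_def)
      then have "2 \<le> card (slice P e)"
        using card_mono[OF finS, of "{x j, y j}"] by simp
      with False show False by simp
    qed
    then show ?thesis using p0 D_nonneg by (simp add: r_def)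
  next
    case True
    define c where "c = pot \<sigma> P / (\<sigma>\<^sup>2 * (r - 1))"
    have c: "c \<ge> 0" using p0 \<sigma> True by (simp add: c_def r_def)
    \<comment> \<open>Ordered pairs of distinct open variables; their count contains the factor r -
      1 that cancels the denominator of \<open>c\<close>.\<close>
    define Q where "Q = (SIGMA v:slice P e. slice P e - {v})"
    have finQ: "finite Q" using finS by (simp add: Q_def)
    have cardQ: "real (card Q) = r * (r - 1)"
      using finS True by (simp add: Q_def r_def)
    have "f j = c * b j" if "j \<in> J11" for j
    proof -
      have j: "x j \<in> P" "y j \<in> P" "x j \<noteq> y j" "col (x j) = e" "col (y j) = e"
        using that x_neq_y[of j] col_eq[of j] by (auto simp: defs)
      let ?P = "P - {y j} - {x j}"
      have P_eq: "P = insert (x j) (insert (y j) ?P)" using j by auto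
      have "slice P e = insert (x j) (insert (y j) (slice ?P e))"
        using j by (auto simp: slice_def)
      then have "card (slice P e) = Suc (Suc (card (slice ?P e)))"
        using finP j by (simp add: slice_def)
      then have "pot \<sigma> P = \<sigma>\<^sup>2 * (r - 1) * pot \<sigma> ?P"
        using pot_insert2[of ?P "x j" "y j" e \<sigma>] P_eq finP j e by (simp add: r_def)
      then have "pot \<sigma> ?P = c"
        using \<sigma> True by (simp add: c_def r_def)
      moreover have "toggle (x j) (toggle (y j) P) = ?P"
        using j by (simp add: toggle_def)
      ultimately show ?thesis by (simp add: f_def)
    qed
    then have "sum f J11 = sum b J11 * c"
      by (simp add: sum_distrib_right mult.commute[of c])
    also have "sum b J11 \<le> sum b (\<Union>w\<in>Q. {j\<in>J. x j = fst w \<and> y j = snd w})"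
      using finite_J finQ b col_eq not_sym[OF x_neq_y]
      by (intro sum_mono2) (auto simp: defs slice_def Q_def)
    also have "\<dots> \<le> (\<Sum>w\<in>Q. sum b {j\<in>J. x j = fst w \<and> y j = snd w})"
      using finite_J finQ by (subst sum.UNION_disjoint) (auto simp: prod_eq_iff)
    also have "\<dots> \<le> (\<Sum>w\<in>Q. D * \<kappa>\<^sup>2)"
      unfolding b_def using P by (intro sum_mono close_close[OF s]) (auto simp: slice_def Q_def)
    also have "\<dots> = r * (r - 1) * (D * \<kappa>\<^sup>2)"
      by (simp add: cardQ)
    finally have "sum f J11 \<le> r * (r - 1) * (D * \<kappa>\<^sup>2) * c"
      using c by (simp add: mult_right_mono)
    also have "\<dots> = r * (D * \<kappa>\<^sup>2) * (pot \<sigma> P / \<sigma>\<^sup>2)"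
      using True \<sigma> by (simp add: c_def r_def field_simps)
    finally show ?thesis .
  qed
  show ?thesis
    using b00 b10 b01 b11 unfolding split by (simp add: algebra_simps add_divide_distrib)
qed

text \<open>The growth per step, from \<open>sum_pot_le\<close> summed over all colours. The
  constant parts give \<open>card C\<close>; the parts linear in r form a complete square,
  multiplied by the number of open variables, which never needs to exceed 2K.\<close>

definition rate :: "real \<Rightarrow> nat \<Rightarrow> real" where
  "rate \<sigma> K = D * (\<omega>\<^sup>2 * \<sigma>\<^sup>2 * card C + 2 * K * (\<omega> * \<sigma> + \<kappa> / \<sigma>)\<^sup>2)"

lemma rate_nonneg: "rate \<sigma> K \<ge> 0"
  using D_nonneg by (simp add: rate_def)

text \<open>The budget \<open>K\<close> is fixed during the induction so that the rate stays
  constant. Sets with more than 2K elements have vanishing coefficient, and for the others the slice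
  sizes add up to at most 2K. Nonnegativity of \<open>B\<close> lets a one-sided bound pass through
  the recursion.\<close>

lemma coeff_le:
  assumes "k \<le> K" "P \<subseteq> V" "s \<in> I" and \<sigma>: "\<sigma> > 0"
  shows "coeff s\<^sub>0 k s P \<le> card (sign_vectors V) * rate \<sigma> K ^ k * pot \<sigma> P"
  using assms(1-3)
proof (induction k arbitrary: s P)
  case 0
  show ?case
  proof (cases "P = {}")
    case True
    then show ?thesis by (simp add: coeff_def pot_def slice_def)
  next
    case False
    then have "card P > 0"
      using 0 finite_V by (simp add: card_gt_0_iff finite_subset)
    then show ?thesis
      using \<sigma> coeff_eq_0[OF 0(2), of 0] by (simp add: pot_nonneg)
  qed
next
  case (Suc k)
  let ?R = "card (sign_vectors V) * rate \<sigma> K ^ k"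
  have R: "?R \<ge> 0" using rate_nonneg by simp
  have p0: "pot \<sigma> P \<ge> 0" using \<sigma> by (intro pot_nonneg) simp
  show ?case
  proof (cases "card P \<le> 2 * K")
    case False
    then have "coeff s\<^sub>0 (Suc k) s P = 0"
      using Suc.prems by (intro coeff_eq_0) auto
    then show ?thesis using p0 rate_nonneg by simp
  next
    case True
    have finP: "finite P" using Suc.prems finite_V finite_subset by blast
    define r where "r e = real (card (slice P e))" for e
    have sum_r: "(\<Sum>e\<in>C. r e) \<le> 2 * K"
    proof -
      have "(\<Sum>e\<in>C. card (slice P e)) = card (\<Union>e\<in>C. slice P e)"
        using finP finite_C by (subst card_UN_disjoint) (auto simp: slice_def)
      also have "\<dots> \<le> card P"
        using finP by (intro card_mono) (auto simp: slice_def)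
      finally have "(\<Sum>e\<in>C. card (slice P e)) \<le> 2 * K" using True by simp
      then show ?thesis unfolding r_def by (simp flip: of_nat_sum of_nat_mult)
    qed
    have "coeff s\<^sub>0 (Suc k) s P
        = (\<Sum>j\<in>J. \<Sum>t\<in>I. B j s t * coeff s\<^sub>0 k t (toggle (x j) (toggle (y j) P)))"
      using Suc.prems by (simp add: coeff_Suc)
    also have "\<dots> \<le> (\<Sum>j\<in>J. \<Sum>t\<in>I. B j s t * (?R * pot \<sigma> (toggle (x j) (toggle (y j) P))))"
      using Suc B_nonneg x_in y_in by (intro sum_mono mult_left_mono Suc.IH toggle_subset) auto
    also have "\<dots> = ?R * (\<Sum>j\<in>J. (\<Sum>t\<in>I. B j s t) * pot \<sigma> (toggle (x j) (toggle (y j) P)))"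
      by (simp add: sum_distrib_left sum_distrib_right mult_ac)
    also have "(\<Sum>j\<in>J. (\<Sum>t\<in>I. B j s t) * pot \<sigma> (toggle (x j) (toggle (y j) P)))
        = (\<Sum>e\<in>C. \<Sum>j | j \<in> J \<and> col (x j) = e.
            (\<Sum>t\<in>I. B j s t) * pot \<sigma> (toggle (x j) (toggle (y j) P)))"
      using finite_J finite_C col_in by (intro sum.group[symmetric]) auto
    also have "\<dots> \<le> (\<Sum>e\<in>C. D * pot \<sigma> P *
        (\<omega>\<^sup>2 * \<sigma>\<^sup>2 * (r e + 1) + 2 * \<omega> * \<kappa> * r e + \<kappa>\<^sup>2 * r e / \<sigma>\<^sup>2))"
      unfolding r_def using Suc.prems \<sigma> by (intro sum_mono sum_pot_le)
    also have "\<dots> = (\<Sum>e\<in>C. D * pot \<sigma> P * (\<omega>\<^sup>2 * \<sigma>\<^sup>2 + r e * (\<omega> * \<sigma> + \<kappa> / \<sigma>)\<^sup>2))"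
      using \<sigma> by (intro sum.cong) (auto simp: power2_eq_square field_simps)
    also have "\<dots> = D * pot \<sigma> P * (\<omega>\<^sup>2 * \<sigma>\<^sup>2 * card C + (\<Sum>e\<in>C. r e) * (\<omega> * \<sigma> + \<kappa> / \<sigma>)\<^sup>2)"
      by (simp add: sum_distrib_left sum_distrib_right sum.distrib algebra_simps)
    also have "\<dots> \<le> D * pot \<sigma> P * (\<omega>\<^sup>2 * \<sigma>\<^sup>2 * card C + 2 * K * (\<omega> * \<sigma> + \<kappa> / \<sigma>)\<^sup>2)"
      using p0 D_nonneg sum_r by (intro mult_left_mono add_left_mono mult_right_mono) auto
    also have "\<dots> = rate \<sigma> K * pot \<sigma> P" by (simp add: rate_def)
    finally have "coeff s\<^sub>0 (Suc k) s P \<le> ?R * (rate \<sigma> K * pot \<sigma> P)"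
      using R by (simp add: mult_left_mono)
    then show ?thesis by (simp add: mult_ac)
  qed
qed

text \<open>The trace collects the coefficients at the empty set, where the potential equals
  one.\<close>

lemma sum_trace_chaos_le:
  assumes "\<sigma> > 0"
  shows "(\<Sum>Y\<in>sign_vectors V. \<Sum>s\<in>I. mat_pow I (chaos Y) K s s)
       \<le> card (sign_vectors V) * card I * rate \<sigma> K ^ K"
proof -
  have "(\<Sum>Y\<in>sign_vectors V. \<Sum>s\<in>I. mat_pow I (chaos Y) K s s) = (\<Sum>s\<in>I. coeff s K s {})"
    by (subst sum.swap) (simp add: coeff_def)
  also have "\<dots> \<le> (\<Sum>s\<in>I. card (sign_vectors V) * rate \<sigma> K ^ K * pot \<sigma> {})"
    using assms by (intro sum_mono coeff_le) auto
  finally show ?thesis by (simp add: pot_def slice_def mult_ac)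
qed

text \<open>With \<open>\<sigma>\<^sup>2 = \<beta> * \<kappa> / \<omega>\<close> and N colours, the
  rate is D \<omega> \<kappa> times \<beta> N + 2K (\<beta> + 2 + 1/\<beta>). For K of order X the
  competing terms \<beta> N and X / \<beta> balance at \<beta> = sqrt(X / N), where both equal
  sqrt(X N).\<close>

lemma rate_le:
  fixes X :: real
  assumes X: "X > 0" "X \<le> card C" and K: "K \<le> 3 * X"
  obtains \<sigma> where "\<sigma> > 0" "rate \<sigma> K \<le> 25 * D * \<omega> * \<kappa> * sqrt (X * card C)"
proof -
  define N where "N = real (card C)"
  define \<beta> where "\<beta> = sqrt (X / N)"
  define R where "R = sqrt (X * N)"
  define \<sigma> where "\<sigma> = sqrt (\<beta> * \<kappa> / \<omega>)"
  have N: "N > 0" "X \<le> N" using X by (auto simp: N_def)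
  have \<beta>: "\<beta> > 0" "\<beta> \<le> 1" using X N by (auto simp: \<beta>_def)
  have "\<sigma> > 0" using \<beta> \<omega>_pos \<kappa>_pos by (simp add: \<sigma>_def)
  have \<sigma>2: "\<sigma>\<^sup>2 = \<beta> * \<kappa> / \<omega>" using \<beta> \<omega>_pos \<kappa>_pos by (simp add: \<sigma>_def)
  have "(\<omega> * \<sigma> + \<kappa> / \<sigma>)\<^sup>2 = \<omega>\<^sup>2 * \<sigma>\<^sup>2 + 2 * \<omega> * \<kappa> + \<kappa>\<^sup>2 / \<sigma>\<^sup>2"
    using \<open>\<sigma> > 0\<close> by (simp add: power2_eq_square field_simps)
  also have "\<dots> = \<omega> * \<kappa> * (\<beta> + 2 + 1 / \<beta>)"
    unfolding \<sigma>2 using \<beta> \<omega>_pos \<kappa>_pos by (simp add: power2_eq_square field_simps)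
  finally have "rate \<sigma> K = D * \<omega> * \<kappa> * (\<beta> * N + 2 * K * (\<beta> + 2 + 1 / \<beta>))"
    unfolding rate_def \<sigma>2 using \<omega>_pos by (simp add: N_def power2_eq_square field_simps)
  also have "\<dots> \<le> D * \<omega> * \<kappa> * (25 * R)"
  proof (intro mult_left_mono)
    have "\<beta> * N = sqrt (X / N) * sqrt (N * N)"
      using N by (simp add: \<beta>_def)
    also have "\<dots> = R" unfolding R_def real_sqrt_mult[symmetric] using N by simp
    finally have \<beta>N: "\<beta> * N = R" .
    have "X = \<beta> * R" using N X by (simp add: \<beta>_def R_def flip: real_sqrt_mult)
    then have X\<beta>: "X / \<beta> = R" using \<beta> by simp
    have R: "R \<ge> 0" using X N by (simp add: R_def)
    have XR: "X \<le> R" using \<open>X = \<beta> * R\<close> \<beta> R by (simp add: mult_left_le_one_le)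
    have "X * \<beta> \<le> X" using X \<beta> by (simp add: mult_left_le)
    \<comment> \<open>Since \<beta> is at most 1, both X \<beta> and X are bounded by X / \<beta> =
      R, which gives 6 + 12 + 6 = 24; the remaining 1 in the constant 25 comes from \<beta>
      N.\<close>
    have "2 * real K * (\<beta> + 2 + 1 / \<beta>) \<le> 2 * (3 * X) * (\<beta> + 2 + 1 / \<beta>)"
      using K \<beta> by (intro mult_right_mono mult_left_mono) auto
    also have "\<dots> = 6 * (X * \<beta>) + 12 * X + 6 * (X / \<beta>)" by (simp add: algebra_simps)
    also have "\<dots> \<le> 24 * R" using \<open>X * \<beta> \<le> X\<close> XR X\<beta> by linarith
    finally show "\<beta> * N + 2 * K * (\<beta> + 2 + 1 / \<beta>) \<le> 25 * R" using \<beta>N by simp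
  qed (use D_nonneg \<omega>_pos \<kappa>_pos in auto)
  finally have "rate \<sigma> K \<le> 25 * D * \<omega> * \<kappa> * sqrt (X * card C)"
    by (simp add: R_def N_def mult_ac)
  with \<open>\<sigma> > 0\<close> show ?thesis by (rule that)
qed

text \<open>Markov's inequality in counting form: every bad sign vector contributes at least
  \<open>\<tau> ^ (2 * k)\<close> to the total trace, and no sign vector contributes a negative
  amount.\<close>

lemma card_large_op_norm_le:
  fixes \<tau> :: real
  assumes sym: "\<And>Y s t. s \<in> I \<Longrightarrow> t \<in> I \<Longrightarrow> chaos Y s t = chaos Y t s"
    and k: "k > 0" and \<tau>: "\<tau> > 0" and \<sigma>: "\<sigma> > 0"
  shows "card {Y \<in> sign_vectors V. op_norm I (chaos Y) > \<tau>} * \<tau> ^ (2 * k)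
       \<le> card (sign_vectors V) * card I * rate \<sigma> (2 * k) ^ (2 * k)"
proof -
  define tr where "tr Y = (\<Sum>s\<in>I. mat_pow I (chaos Y) (2 * k) s s)" for Y
  \<comment> \<open>The zero vector makes the left side of the norm-trace inequality zero.\<close>
  have tr_nonneg: "tr Y \<ge> 0" for Y
    using mat_vec_norm_power_le_trace[OF finite_I sym, where v = "\<lambda>_. 0" and k = k] k
    by (simp add: tr_def mat_vec_def power_0_left)
  have "card {Y \<in> sign_vectors V. op_norm I (chaos Y) > \<tau>} * \<tau> ^ (2 * k)
      = (\<Sum>Y | Y \<in> sign_vectors V \<and> op_norm I (chaos Y) > \<tau>. \<tau> ^ (2 * k))" by simp
  also have "\<dots> \<le> (\<Sum>Y | Y \<in> sign_vectors V \<and> op_norm I (chaos Y) > \<tau>. tr Y)"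
  proof (rule sum_mono, rule ccontr, goal_cases)
    case (1 Y)
    then have "op_norm I (chaos Y) \<le> \<tau>"
      using finite_I sym k \<tau> by (intro op_norm_le_of_trace[of I _ k]) (auto simp: tr_def)
    with 1 show ?case by simp
  qed
  also have "\<dots> \<le> (\<Sum>Y\<in>sign_vectors V. tr Y)"
    using finite_sign_vectors[OF finite_V] tr_nonneg by (intro sum_mono2) auto
  also have "\<dots> \<le> card (sign_vectors V) * card I * rate \<sigma> (2 * k) ^ (2 * k)"
    unfolding tr_def by (rule sum_trace_chaos_le[OF \<sigma>])
  finally show ?thesis .
qed

end

section \<open>Counting linked tuples\<close>

lemma finite_tuples: "finite (tuples n k)"
  using finite_lists_length_eq[of "{..<n}" k] by (simp add: tuples_def conj_commute)

lemma card_tuples: "card (tuples n k) = n ^ k"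
  using card_lists_length_eq[of "{..<n}" k] by (simp add: tuples_def conj_commute)

lemma append_in_tuples: "xs \<in> tuples n j \<Longrightarrow> ys \<in> tuples n k \<Longrightarrow> xs @ ys \<in> tuples n (j + k)"
  by (auto simp: tuples_def)

lemma length_tuples: "xs \<in> tuples n k \<Longrightarrow> length xs = k"
  by (simp add: tuples_def)

text \<open>With \<open>map\<close> in place of pointwise equations, a splitting of \<open>u\<close>
  and \<open>v\<close> into two pieces becomes a splitting of the index list.\<close>

lemma link_dir_iff:
  assumes "length v = length u"
  shows "link_dir l u v S T \<longleftrightarrow>
    (\<exists>idx. distinct idx \<and> set idx \<subseteq> {..<l} \<and> map ((!) S) idx = u \<and> map ((!) T) idx = v \<and>
       (\<forall>i<l. i \<notin> set idx \<longrightarrow> S ! i \<notin> set u \<union> set v \<and> T ! i \<notin> set u \<union> set v \<and> S ! i = T ! i))"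
  unfolding link_dir_def using assms
  by (intro ex_cong1) (auto simp: list_eq_iff_nth_eq)

lemma link_dir_sym:
  assumes "length v = length u"
  shows "link_dir l u v S T \<longleftrightarrow> link_dir l v u T S"
  using assms unfolding link_dir_iff[OF assms] link_dir_iff[OF assms[symmetric]]
  by (intro ex_cong1) auto

text \<open>Swapping the two blocks of the index list does not change the set of linked positions.
  This lets the second variable of a term play the role of the first.\<close>

lemma link_dir_append_swap:
  assumes "length v1 = length u1" "length v2 = length u2" and "link_dir l (u1 @ u2) (v1 @ v2) S T"
  shows "link_dir l (u2 @ u1) (v2 @ v1) S T"
proof -
  have len: "length (v1 @ v2) = length (u1 @ u2)" "length (v2 @ v1) = length (u2 @ u1)"
    using assms by auto
  obtain idx where idx: "distinct idx" "set idx \<subseteq> {..<l}" "map ((!) S) idx = u1 @ u2" "map ((!) T) idx = v1 @ v2"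
    "\<forall>i<l. i \<notin> set idx \<longrightarrow> S ! i \<notin> set (u1 @ u2) \<union> set (v1 @ v2) \<and> T ! i \<notin> set (u1 @ u2) \<union> set (v1 @ v2) \<and> S ! i = T ! i"
    using assms(3) unfolding link_dir_iff[OF len(1)] by blast
  obtain i1 i2 where i: "idx = i1 @ i2" "map ((!) S) i1 = u1" "map ((!) S) i2 = u2"
    using idx(3) by (metis map_eq_append_conv)
  have "length i1 = length v1" "length i2 = length v2"
    using i assms by auto
  then have "map ((!) T) i1 = v1" "map ((!) T) i2 = v2"
    using idx(4) i(1) by auto
  with i idx show ?thesis
    unfolding link_dir_iff[OF len(2)] by (intro exI[of _ "i2 @ i1"]) auto
qed

text \<open>The list \<open>u\<close> written at the positions \<open>idx\<close> over the
  background \<open>f\<close>. It serves to reconstruct a link target from its source and to build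
  linked pairs over a common background.\<close>

definition fill :: "nat \<Rightarrow> nat list \<Rightarrow> 'a list \<Rightarrow> (nat \<Rightarrow> 'a) \<Rightarrow> 'a list" where
  "fill l idx u f = map (\<lambda>i. case map_of (zip idx u) i of Some z \<Rightarrow> z | None \<Rightarrow> f i) [0..<l]"

lemma length_fill [simp]: "length (fill l idx u f) = l"
  by (simp add: fill_def)

lemma nth_fill_out: "i < l \<Longrightarrow> i \<notin> set idx \<Longrightarrow> length u = length idx \<Longrightarrow> fill l idx u f ! i = f i"
  by (simp add: fill_def map_of_zip_is_None[THEN iffD2] del: map_of_zip_is_None)

lemma nth_fill_in:
  "distinct idx \<Longrightarrow> set idx \<subseteq> {..<l} \<Longrightarrow> length u = length idx \<Longrightarrow> j < length idx
    \<Longrightarrow> fill l idx u f ! (idx ! j) = u ! j"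
  using nth_mem[of j idx] by (auto simp: fill_def map_of_zip_nth subset_iff)

lemma map_nth_fill:
  "distinct idx \<Longrightarrow> set idx \<subseteq> {..<l} \<Longrightarrow> length u = length idx \<Longrightarrow> map ((!) (fill l idx u f)) idx = u"
  by (simp add: list_eq_iff_nth_eq nth_fill_in)

lemma fill_eqI:
  assumes "length T = l" "distinct idx" "set idx \<subseteq> {..<l}" "map ((!) T) idx = v"
    and "\<And>i. i < l \<Longrightarrow> i \<notin> set idx \<Longrightarrow> T ! i = f i"
  shows "T = fill l idx v f"
proof (rule nth_equalityI)
  fix i assume "i < length T"
  show "T ! i = fill l idx v f ! i"
  proof (cases "i \<in> set idx")
    case True
    then obtain j where "j < length idx" "i = idx ! j" by (metis in_set_conv_nth)
    then show ?thesis using assms by (auto simp: nth_fill_in)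
  next
    case False
    then show ?thesis using assms \<open>i < length T\<close> by (auto simp: nth_fill_out)
  qed
qed (use assms in simp)

text \<open>The positions carrying the prescribed prefix \<open>u1\<close> lie in a set of at most \<open>m1 + m2\<close>
  positions, because the linked values occur nowhere else.\<close>

lemma card_link_dir_le:
  assumes "length u1 = m1" "length v1 = m1" "length S = l"
  shows "card {(u2, v2, T). u2 \<in> tuples n m2 \<and> v2 \<in> tuples n m2 \<and> T \<in> tuples n l
            \<and> link_dir l (u1 @ u2) (v1 @ v2) S T}
       \<le> (m1 + m2) ^ m1 * l ^ m2 * n ^ m2"
    (is "card ?X \<le> _")
\<comment> \<open>The bound on the number of candidate positions is read off from an existing link;
  without one, the values of \<open>u1\<close> could occur in \<open>S\<close> arbitrarily
  often.\<close>
proof (cases "?X = {}")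
  case True
  show ?thesis unfolding True by simp
next
  case False
  define P where "P = {i. i < l \<and> S ! i \<in> set u1}"
  \<comment> \<open>A link is encoded by the positions of the prefix, the positions of the rest and
    the new values \<open>v2\<close>. The list \<open>u2\<close> is read from \<open>S\<close>, and
    the target is \<open>S\<close> overwritten at both groups of positions.\<close>
  define Z where "Z = {xs. set xs \<subseteq> P \<and> length xs = m1} \<times> tuples l m2 \<times> tuples n m2"
  define g where "g = (\<lambda>(i1, i2, v2). (map ((!) S) i2, v2, fill l (i1 @ i2) (v1 @ v2) ((!) S)))"
  have finP: "finite P" by (simp add: P_def)
  have key: "\<exists>i1 i2. length i1 = m1 \<and> length i2 = m2 \<and> set i1 \<subseteq> P \<and> set i2 \<subseteq> {..<l} \<and> P \<subseteq> set (i1 @ i2)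
      \<and> u2 = map ((!) S) i2 \<and> T = fill l (i1 @ i2) (v1 @ v2) ((!) S)"
    if "(u2, v2, T) \<in> ?X" for u2 v2 T
  proof -
    have len: "length (v1 @ v2) = length (u1 @ u2)" "length T = l" "length u2 = m2"
      using that assms by (auto simp: tuples_def)
    from that obtain idx where idx: "distinct idx" "set idx \<subseteq> {..<l}" "map ((!) S) idx = u1 @ u2" "map ((!) T) idx = v1 @ v2"
      "\<forall>i<l. i \<notin> set idx \<longrightarrow> S ! i \<notin> set (u1 @ u2) \<union> set (v1 @ v2) \<and> T ! i \<notin> set (u1 @ u2) \<union> set (v1 @ v2) \<and> S ! i = T ! i"
      unfolding mem_Collect_eq prod.case link_dir_iff[OF len(1)] by blast
    obtain i1 i2 where i: "idx = i1 @ i2" "map ((!) S) i1 = u1" "map ((!) S) i2 = u2"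
      using idx(3) by (metis map_eq_append_conv)
    have "T = fill l idx (v1 @ v2) ((!) S)"
      using idx len by (intro fill_eqI) auto
    then show ?thesis
      using i idx assms len by (intro exI[of _ i1] exI[of _ i2]) (auto simp: P_def)
  qed
  have "?X \<subseteq> g ` Z"
  proof
    fix w assume "w \<in> ?X"
    then obtain u2 v2 T where w: "w = (u2, v2, T)" "(u2, v2, T) \<in> ?X" by blast
    from key[OF w(2)] obtain i1 i2 where "length i1 = m1" "length i2 = m2" "set i1 \<subseteq> P" "set i2 \<subseteq> {..<l}"
      "u2 = map ((!) S) i2" "T = fill l (i1 @ i2) (v1 @ v2) ((!) S)" by blast
    with w show "w \<in> g ` Z"
      by (intro image_eqI[of _ _ "(i1, i2, v2)"]) (auto simp: g_def Z_def tuples_def)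
  qed
  moreover have finZ: "finite Z"
    using finP by (auto simp: Z_def finite_tuples intro!: finite_lists_length_eq)
  ultimately have "card ?X \<le> card Z" by (meson surj_card_le)
  also have "card Z = card P ^ m1 * (l ^ m2 * n ^ m2)"
    using finP by (simp add: Z_def card_cartesian_product card_lists_length_eq card_tuples)
  also have "card P \<le> m1 + m2"
  proof -
    from False obtain u2 v2 T where "(u2, v2, T) \<in> ?X" by blast
    from key[OF this] obtain i1 i2 where i: "length i1 = m1" "length i2 = m2" "P \<subseteq> set (i1 @ i2)" by blast
    then have "card P \<le> card (set (i1 @ i2))" by (intro card_mono) auto
    also have "\<dots> \<le> m1 + m2" using card_length[of "i1 @ i2"] i by simp
    finally show ?thesis .
  qed
  finally show ?thesis by (simp add: power_mono mult.assoc)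
qed

text \<open>A set of m positions receives \<open>u\<close> in the source and \<open>v\<close> in the
  target, in increasing order; the other positions share values outside the at most 2m forbidden
  ones. The fixed order prevents repeated entries of \<open>u\<close> from causing double
  counts.\<close>

lemma card_link_dir_ge:
  assumes u: "u \<in> tuples n m" and v: "v \<in> tuples n m"
  shows "(l choose m) * (n - 2 * m) ^ (l - m)
       \<le> card {(S, T). S \<in> tuples n l \<and> T \<in> tuples n l \<and> link_dir l u v S T}"
    (is "_ \<le> card ?X")
proof -
  define A where "A = {..<n} - (set u \<union> set v)"
  have len: "length u = m" "length v = m" "length v = length u" using u v by (auto simp: tuples_def)
  have "card (set u \<union> set v) \<le> 2 * m"
    using card_Un_le[of "set u" "set v"] card_length[of u] card_length[of v] len by simp
  then have cardA: "n - 2 * m \<le> card A"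
    using diff_card_le_card_Diff[of "set u \<union> set v" "{..<n}"] by (simp add: A_def)
  define W where "W = (SIGMA I:{I. I \<subseteq> {..<l} \<and> card I = m}. ({..<l} - I) \<rightarrow>\<^sub>E A)"
  have finW1: "finite {I. I \<subseteq> {..<l} \<and> card I = m}" by simp
  have "(l choose m) * (n - 2 * m) ^ (l - m) \<le> (l choose m) * card A ^ (l - m)"
    using cardA by (simp add: power_mono)
  also have "\<dots> = (\<Sum>I | I \<subseteq> {..<l} \<and> card I = m. card A ^ (l - m))"
    by (simp add: n_subsets)
  also have "\<dots> = (\<Sum>I | I \<subseteq> {..<l} \<and> card I = m. card (({..<l} - I) \<rightarrow>\<^sub>E A))"
    by (intro sum.cong refl) (auto simp: card_funcsetE card_Diff_subset finite_subset)
  also have "\<dots> = card W"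
    unfolding W_def by (subst card_SigmaI) (auto simp: A_def intro!: finite_PiE)
  also have "\<dots> \<le> card ?X"
  proof (rule card_inj_on_le)
    define pr where "pr = (\<lambda>(I, f). (fill l (sorted_list_of_set I) u f, fill l (sorted_list_of_set I) v f))"
    have facts: "set (sorted_list_of_set I) = I" "length (sorted_list_of_set I) = m" "distinct (sorted_list_of_set I)"
        "I \<subseteq> {..<l}" "\<And>i. i < l \<Longrightarrow> i \<notin> I \<Longrightarrow> f i \<in> A" "f \<in> extensional ({..<l} - I)"
      if "(I, f) \<in> W" for I f
    proof -
      have "finite I" using that finite_subset by (auto simp: W_def)
      then show "set (sorted_list_of_set I) = I" "length (sorted_list_of_set I) = m" "distinct (sorted_list_of_set I)"
        using that by (auto simp: W_def)
      show "I \<subseteq> {..<l}" "\<And>i. i < l \<Longrightarrow> i \<notin> I \<Longrightarrow> f i \<in> A" "f \<in> extensional ({..<l} - I)"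
        using that by (auto simp: W_def PiE_iff)
    qed
    have in_tuples: "fill l (sorted_list_of_set I) w f \<in> tuples n l"
      if "(I, f) \<in> W" "w \<in> tuples n m" for I f w
    proof -
      note F = facts[OF that(1)]
      have "fill l (sorted_list_of_set I) w f ! i < n" if "i < l" for i
      proof (cases "i \<in> I")
        case True
        then have "i \<in> set (sorted_list_of_set I)" using F(1) by simp
        then obtain j where j: "j < m" "i = sorted_list_of_set I ! j"
          using F(2) unfolding in_set_conv_nth by metis
        then have "fill l (sorted_list_of_set I) w f ! i = w ! j"
          using F \<open>w \<in> tuples n m\<close> by (simp add: nth_fill_in tuples_def)
        then show ?thesis using \<open>w \<in> tuples n m\<close> j nth_mem[of j w]
          by (auto simp: tuples_def subset_iff)
      next
        case False
        then show ?thesis using F that \<open>w \<in> tuples n m\<close>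
          by (auto simp: nth_fill_out tuples_def A_def)
      qed
      then show ?thesis by (auto simp: tuples_def in_set_conv_nth)
    qed
    show "pr ` W \<subseteq> ?X"
    proof (clarsimp simp: pr_def)
      fix I f assume W: "(I, f) \<in> W"
      note F = facts[OF W]
      have "link_dir l u v (fill l (sorted_list_of_set I) u f) (fill l (sorted_list_of_set I) v f)"
        unfolding link_dir_iff[OF len(3)] using F len
        by (intro exI[of _ "sorted_list_of_set I"]) (auto simp: map_nth_fill nth_fill_out A_def)
      then show "fill l (sorted_list_of_set I) u f \<in> tuples n l \<and> fill l (sorted_list_of_set I) v f \<in> tuples n l
          \<and> link_dir l u v (fill l (sorted_list_of_set I) u f) (fill l (sorted_list_of_set I) v f)"
        using in_tuples[OF W] u v by blast
    qed
    \<comment> \<open>The background avoids all values of \<open>u\<close>, so the source alone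
      reveals the chosen positions; this yields injectivity.\<close>
    have I_eq: "I = {i. i < l \<and> fill l (sorted_list_of_set I) u f ! i \<in> set u}" if "(I, f) \<in> W" for I f
    proof -
      note F = facts[OF that]
      have "fill l (sorted_list_of_set I) u f ! i \<in> set u" if "i \<in> I" for i
      proof -
        have "i \<in> set (sorted_list_of_set I)" using F(1) that by simp
        then obtain j where j: "j < m" "i = sorted_list_of_set I ! j"
          using F(2) unfolding in_set_conv_nth by metis
        then show ?thesis using F len by (simp add: nth_fill_in)
      qed
      moreover have "i \<in> I" if "i < l" "fill l (sorted_list_of_set I) u f ! i \<in> set u" for i
        using that F len by (cases "i \<in> I") (auto simp: nth_fill_out A_def)
      ultimately show ?thesis using F(4) by (intro set_eqI) blast
    qed
    show "inj_on pr W"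
    proof (rule inj_onI, clarify)
      fix I f I' f' assume W: "(I, f) \<in> W" "(I', f') \<in> W" and eq: "pr (I, f) = pr (I', f')"
      then have eq: "fill l (sorted_list_of_set I) u f = fill l (sorted_list_of_set I') u f'"
        by (simp add: pr_def)
      have II: "I = I'" using I_eq[OF W(1)] I_eq[OF W(2)] eq by simp
      have "f = f'"
      proof (rule extensionalityI)
        show "f \<in> extensional ({..<l} - I)" "f' \<in> extensional ({..<l} - I)"
          using facts[OF W(1)] facts[OF W(2)] II by auto
        fix i assume "i \<in> {..<l} - I"
        then show "f i = f' i"
          using arg_cong[OF eq, of "\<lambda>S. S ! i"] facts[OF W(1)] II len by (simp add: nth_fill_out)
      qed
      with II show "I = I' \<and> f = f'" by simp
    qed
    show "finite ?X"
      by (rule finite_subset[of _ "tuples n l \<times> tuples n l"]) (auto simp: finite_tuples)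
  qed
  finally show ?thesis .
qed

section \<open>The quadratic form of the Kikuchi matrix\<close>

abbreviation mon :: "(nat \<Rightarrow> real) \<Rightarrow> nat list \<Rightarrow> real" where
  "mon x S \<equiv> prod_list (map x S)"

lemma sum_tuples_append:
  "(\<Sum>t\<in>tuples n (j + k). f t) = (\<Sum>a\<in>tuples n j. \<Sum>b\<in>tuples n k. f (a @ b))"
proof -
  have "bij_betw (\<lambda>(a, b). a @ b) (tuples n j \<times> tuples n k) (tuples n (j + k))"
  proof (rule bij_betw_byWitness[where f' = "\<lambda>t. (take j t, drop j t)"])
    show "(\<lambda>t. (take j t, drop j t)) ` tuples n (j + k) \<subseteq> tuples n j \<times> tuples n k"
      by (auto simp: tuples_def dest!: in_set_takeD in_set_dropD)
  qed (auto simp: tuples_def)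
  from sum.reindex_bij_betw[OF this, of f] show ?thesis
    by (simp add: sum.cartesian_product case_prod_unfold)
qed

lemma sum_tuples_1: "(\<Sum>t\<in>tuples n (Suc 0). f t) = (\<Sum>e<n. f [e])"
proof -
  have "tuples n (Suc 0) = (\<lambda>e. [e]) ` {..<n}"
    by (auto simp: tuples_def length_Suc_conv)
  then show ?thesis by (simp add: sum.reindex inj_on_def)
qed

definition flat_vectors :: "nat \<Rightarrow> (nat \<Rightarrow> real) set" where
  "flat_vectors n = PiE {..<n} (\<lambda>_. {-1 / sqrt (real n), 1 / sqrt (real n)})"

lemma flat_vectors_square:
  assumes "x \<in> flat_vectors n" "i < n"
  shows "x i * x i = 1 / real n"
proof -
  have "x i = -1 / sqrt (real n) \<or> x i = 1 / sqrt (real n)"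
    using PiE_mem[OF assms(1)[unfolded flat_vectors_def], of i] assms(2) by simp
  then show ?thesis by auto
qed

lemma mon_square:
  assumes "x \<in> flat_vectors n" "S \<in> tuples n k"
  shows "mon x S * mon x S = 1 / real n ^ k"
proof -
  have "set S \<subseteq> {..<n} \<Longrightarrow> mon x S * mon x S = 1 / real n ^ length S"
  proof (induction S)
    case (Cons i S)
    have "mon x (i # S) * mon x (i # S) = (x i * x i) * (mon x S * mon x S)" by simp
    with Cons flat_vectors_square[OF assms(1), of i] show ?case by simp
  qed simp
  with assms(2) show ?thesis by (auto simp: tuples_def)
qed

lemma sum_mon_square:
  assumes "x \<in> flat_vectors n" "n > 0"
  shows "(\<Sum>S\<in>tuples n k. mon x S * mon x S) = 1"
  using assms by (simp add: mon_square card_tuples)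

text \<open>Off the linked positions the two tuples agree and each position contributes a square
  1/n; on them the index list spells out \<open>u\<close> and \<open>v\<close>.\<close>

lemma mon_link_dir:
  assumes x: "x \<in> flat_vectors n" and "length v = length u" and S: "S \<in> tuples n l" and T: "T \<in> tuples n l"
    and "link_dir l u v S T"
  shows "mon x S * mon x T = mon x u * mon x v * (1 / real n) ^ (l - length u)"
proof -
  obtain idx where idx: "distinct idx" "set idx \<subseteq> {..<l}" "map ((!) S) idx = u" "map ((!) T) idx = v"
    "\<forall>i<l. i \<notin> set idx \<longrightarrow> S ! i = T ! i"
    using assms(5) unfolding link_dir_iff[OF assms(2)] by blast
  have split: "mon x R = mon x (map ((!) R) idx) * (\<Prod>i\<in>{..<l} - set idx. x (R ! i))"
    if "length R = l" for R
  proof -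
    have "mon x R = (\<Prod>i\<in>{..<l}. x (R ! i))"
      using that using prod.list_conv_set_nth[of "map x R"] by (simp add: atLeast0LessThan)
    also have "\<dots> = (\<Prod>i\<in>{..<l} - set idx. x (R ! i)) * (\<Prod>i\<in>set idx. x (R ! i))"
      using idx(2) by (intro prod.subset_diff) auto
    also have "(\<Prod>i\<in>set idx. x (R ! i)) = mon x (map ((!) R) idx)"
      using idx(1) by (simp add: prod.distinct_set_conv_list o_def)
    finally show ?thesis by simp
  qed
  have "(\<Prod>i\<in>{..<l} - set idx. x (S ! i)) * (\<Prod>i\<in>{..<l} - set idx. x (T ! i))
      = (\<Prod>i\<in>{..<l} - set idx. 1 / real n)"
    unfolding prod.distrib[symmetric] using idx(5) T flat_vectors_square[OF x] nth_mem[of _ T]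
    by (intro prod.cong) (auto simp: tuples_def subset_iff)
  also have "\<dots> = (1 / real n) ^ (l - length u)"
  proof -
    have "card ({..<l} - set idx) = l - length u"
      using idx by (auto simp: card_Diff_subset distinct_card)
    then show ?thesis by simp
  qed
  finally have "(\<Prod>i\<in>{..<l} - set idx. x (S ! i)) * (\<Prod>i\<in>{..<l} - set idx. x (T ! i))
      = (1 / real n) ^ (l - length u)" .
  moreover have "length S = l" "length T = l" using S T by (auto simp: tuples_def)
  ultimately show ?thesis
    using split[of S] split[of T] idx(3,4) by (simp add: mult_ac)
qed

lemma mon_linked:
  assumes "x \<in> flat_vectors n" "S \<in> tuples n l" "T \<in> tuples n l" "linked l a b c d S T"
    and "length a = q" "length b = q" "length c = q" "length d = q"
  shows "mon x S * mon x T = mon x a * mon x b * mon x c * mon x d / real n ^ (l - 2 * q)"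
proof -
  have "length (a @ b) = 2 * q" "length (c @ d) = 2 * q" using assms by simp_all
  then have "mon x S * mon x T = mon x (a @ b) * mon x (c @ d) * (1 / real n) ^ (l - 2 * q)"
    using assms(4) mon_link_dir[OF assms(1) _ assms(2,3), of "c @ d" "a @ b"]
      mon_link_dir[OF assms(1) _ assms(2,3), of "a @ b" "c @ d"]
    by (auto simp: linked_def mult.commute)
  then show ?thesis by (simp add: power_one_over mult.assoc)
qed

lemma linked_sym:
  assumes "length a + length b = length c + length d"
  shows "linked l a b c d S T \<longleftrightarrow> linked l a b c d T S"
  using link_dir_sym[of "c @ d" "a @ b"] assms by (auto simp: linked_def)

lemma Ncount_ge:
  assumes "a \<in> tuples n q" "b \<in> tuples n q" "c \<in> tuples n q" "d \<in> tuples n q"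
  shows "(l choose (2 * q)) * (n - 4 * q) ^ (l - 2 * q) \<le> Ncount n l a b c d"
proof -
  have "(l choose (2 * q)) * (n - 2 * (2 * q)) ^ (l - 2 * q)
      \<le> card {(S, T). S \<in> tuples n l \<and> T \<in> tuples n l \<and> link_dir l (a @ b) (c @ d) S T}"
    using append_in_tuples[OF assms(1,2)] append_in_tuples[OF assms(3,4)]
    by (intro card_link_dir_ge) (simp_all add: mult_2)
  also have "\<dots> \<le> Ncount n l a b c d"
    unfolding Ncount_def
    by (rule card_mono, rule finite_subset[of _ "tuples n l \<times> tuples n l"])
      (auto simp: finite_tuples linked_def)
  finally show ?thesis by simp
qed

text \<open>The common monomial is summed over exactly \<open>Ncount\<close> pairs, so the
  normalisation cancels. Positivity of \<open>Ncount\<close> enters here because division by zero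
  yields zero.\<close>

lemma Mmat_quadratic_form:
  assumes x: "x \<in> flat_vectors n"
    and N: "\<And>a b c d. \<lbrakk>a \<in> tuples n q; b \<in> tuples n q; c \<in> tuples n q; d \<in> tuples n q\<rbrakk> \<Longrightarrow> Ncount n l a b c d > 0"
  shows "(\<Sum>S\<in>tuples n l. \<Sum>T\<in>tuples n l. Mmat n q l Y S T * mon x S * mon x T)
    = (\<Sum>a\<in>tuples n q. \<Sum>b\<in>tuples n q. \<Sum>c\<in>tuples n q. \<Sum>d\<in>tuples n q.
        Ttilde n Y a b c d * (mon x a * mon x b * mon x c * mon x d)) / real n ^ (l - 2 * q)"
proof -
  let ?t = "tuples n q" and ?I = "tuples n l"
  define L where "L a b c d S T = (if linked l a b c d S T then 1 else (0::real))" for a b c d S T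
  have inner: "(\<Sum>S\<in>?I. \<Sum>T\<in>?I. L a b c d S T * (mon x S * mon x T))
      = Ncount n l a b c d * (mon x a * mon x b * mon x c * mon x d / real n ^ (l - 2 * q))"
    if "a \<in> ?t" "b \<in> ?t" "c \<in> ?t" "d \<in> ?t" for a b c d
  proof -
    let ?m = "mon x a * mon x b * mon x c * mon x d / real n ^ (l - 2 * q)"
    let ?X = "{(S, T). S \<in> ?I \<and> T \<in> ?I \<and> linked l a b c d S T}"
    have "(\<Sum>S\<in>?I. \<Sum>T\<in>?I. L a b c d S T * (mon x S * mon x T))
        = (\<Sum>w\<in>?I \<times> ?I. if w \<in> ?X then ?m else 0)"
      unfolding sum.cartesian_product
      using mon_linked[OF x, of _ l _ a b c d q] that
      by (intro sum.cong) (auto simp: L_def length_tuples split: if_splits)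
    also have "\<dots> = (\<Sum>w\<in>(?I \<times> ?I) \<inter> ?X. ?m)"
      by (rule sum.inter_restrict[symmetric]) (simp add: finite_tuples)
    also have "(?I \<times> ?I) \<inter> ?X = ?X" by auto
    finally show ?thesis by (simp add: Ncount_def)
  qed
  have "(\<Sum>S\<in>?I. \<Sum>T\<in>?I. Mmat n q l Y S T * mon x S * mon x T)
      = (\<Sum>S\<in>?I. \<Sum>T\<in>?I. \<Sum>a\<in>?t. \<Sum>b\<in>?t. \<Sum>c\<in>?t. \<Sum>d\<in>?t.
          Ttilde n Y a b c d / Ncount n l a b c d * (L a b c d S T * (mon x S * mon x T)))"
    by (simp add: Mmat_def L_def sum_distrib_right mult.assoc)
  also have "\<dots> = (\<Sum>a\<in>?t. \<Sum>b\<in>?t. \<Sum>c\<in>?t. \<Sum>d\<in>?t. \<Sum>S\<in>?I. \<Sum>T\<in>?I.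
          Ttilde n Y a b c d / Ncount n l a b c d * (L a b c d S T * (mon x S * mon x T)))"
    by (simp only: sum.swap[of _ ?t ?I])
  also have "\<dots> = (\<Sum>a\<in>?t. \<Sum>b\<in>?t. \<Sum>c\<in>?t. \<Sum>d\<in>?t.
          Ttilde n Y a b c d / Ncount n l a b c d * (\<Sum>S\<in>?I. \<Sum>T\<in>?I. L a b c d S T * (mon x S * mon x T)))"
    by (simp add: sum_distrib_left)
  also have "\<dots> = (\<Sum>a\<in>?t. \<Sum>b\<in>?t. \<Sum>c\<in>?t. \<Sum>d\<in>?t.
        Ttilde n Y a b c d * (mon x a * mon x b * mon x c * mon x d) / real n ^ (l - 2 * q))"
  proof (intro sum.cong refl)
    fix a b c d assume t: "a \<in> ?t" "b \<in> ?t" "c \<in> ?t" "d \<in> ?t"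
    from N[OF t] show "Ttilde n Y a b c d / Ncount n l a b c d * (\<Sum>S\<in>?I. \<Sum>T\<in>?I. L a b c d S T * (mon x S * mon x T))
        = Ttilde n Y a b c d * (mon x a * mon x b * mon x c * mon x d) / real n ^ (l - 2 * q)"
      unfolding inner[OF t] by simp
  qed
  finally show ?thesis by (simp add: sum_divide_distrib)
qed

lemma tensor_form_square_le:
  assumes x: "x \<in> flat_vectors n" and Y: "Y \<in> rad_tensors n (2 * q + 1)" and n: "n > 0" and l: "2 * q \<le> l"
    and N: "\<And>a b c d. \<lbrakk>a \<in> tuples n q; b \<in> tuples n q; c \<in> tuples n q; d \<in> tuples n q\<rbrakk> \<Longrightarrow> Ncount n l a b c d > 0"
  shows "(\<Sum>t\<in>tuples n (2 * q + 1). Y t * mon x t)\<^sup>2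
       \<le> real n + real n ^ (l - 2 * q) * op_norm (tuples n l) (Mmat n q l Y)"
proof -
  let ?t = "tuples n q" and ?I = "tuples n l"
  define G where "G e = (\<Sum>a\<in>?t. \<Sum>c\<in>?t. Y (a @ c @ [e]) * (mon x a * mon x c))" for e
  have "(\<Sum>t\<in>tuples n (q + (q + Suc 0)). Y t * mon x t) = (\<Sum>e<n. x e * G e)"
    unfolding sum_tuples_append sum_tuples_1 G_def
    by (simp add: sum_distrib_left sum.swap[of _ "{..<n}"] mult_ac)
  also have "\<dots>\<^sup>2 \<le> (\<Sum>e<n. (x e)\<^sup>2) * (\<Sum>e<n. (G e)\<^sup>2)"
    by (rule Cauchy_Schwarz_ineq_sum)
  also have "(\<Sum>e<n. (x e)\<^sup>2) = 1"
    using n by (simp add: power2_eq_square flat_vectors_square[OF x])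
  also have "(\<Sum>e<n. (G e)\<^sup>2) = (\<Sum>a\<in>?t. \<Sum>b\<in>?t. \<Sum>c\<in>?t. \<Sum>d\<in>?t.
        Tt n Y a b c d * (mon x a * mon x b * mon x c * mon x d))"
  proof -
    have "(G e)\<^sup>2 = (\<Sum>a\<in>?t. \<Sum>b\<in>?t. \<Sum>c\<in>?t. \<Sum>d\<in>?t.
        Y (a @ c @ [e]) * Y (b @ d @ [e]) * (mon x a * mon x b * mon x c * mon x d))" for e
      unfolding G_def power2_eq_square sum_product by (simp add: mult_ac)
    then show ?thesis
      by (simp add: Tt_def sum_distrib_right sum.swap[of _ ?t "{..<n}"])
  qed
  \<comment> \<open>The quadruples with a = b and c = d, which \<open>Ttilde\<close> omits,
    contribute n in total: \<open>Tt\<close> equals n there, the monomials equal n^(-2q), and there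
    are n^(2q) of them. This is the source of the summand n^(1/2) in the certificate.\<close>
  also have "\<dots> = (\<Sum>a\<in>?t. \<Sum>b\<in>?t. \<Sum>c\<in>?t. \<Sum>d\<in>?t.
        Ttilde n Y a b c d * (mon x a * mon x b * mon x c * mon x d)) +
      (\<Sum>a\<in>?t. \<Sum>b\<in>?t. \<Sum>c\<in>?t. \<Sum>d\<in>?t.
        if d = c then if b = a then real n * (1 / real n ^ q * (1 / real n ^ q)) else 0 else 0)"
  proof -
    have "Tt n Y a b c d * (mon x a * mon x b * mon x c * mon x d)
        = Ttilde n Y a b c d * (mon x a * mon x b * mon x c * mon x d)
        + (if d = c then if b = a then real n * (1 / real n ^ q * (1 / real n ^ q)) else 0 else 0)"
      if "a \<in> ?t" "b \<in> ?t" "c \<in> ?t" "d \<in> ?t" for a b c d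
    proof (cases "a = b \<and> c = d")
      case True
      have "Y (a @ c @ [e]) * Y (a @ c @ [e]) = 1" if "e < n" for e
      proof -
        have "a @ c @ [e] \<in> tuples n (2 * q + 1)"
          using \<open>a \<in> ?t\<close> \<open>c \<in> ?t\<close> that by (auto simp: tuples_def)
        then have "Y (a @ c @ [e]) = -1 \<or> Y (a @ c @ [e]) = 1"
          using Y by (auto simp: rad_tensors_def dest: PiE_mem)
        then show ?thesis by auto
      qed
      then have "Tt n Y a a c c = real n" by (simp add: Tt_def)
      moreover have "mon x a * mon x a * mon x c * mon x c = 1 / real n ^ q * (1 / real n ^ q)"
        using mon_square[OF x, of a q] mon_square[OF x, of c q] that by (simp add: mult.assoc)
      ultimately show ?thesis using True by (simp add: Ttilde_def)
    next
      case False
      then show ?thesis using that by (auto simp: Ttilde_def tuples_def)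
    qed
    then show ?thesis by (simp flip: sum.distrib)
  qed
  also have "(\<Sum>a\<in>?t. \<Sum>b\<in>?t. \<Sum>c\<in>?t. \<Sum>d\<in>?t.
        if d = c then if b = a then real n * (1 / real n ^ q * (1 / real n ^ q)) else 0 else 0)
      = (\<Sum>a\<in>?t. \<Sum>b\<in>?t. if b = a then \<Sum>c\<in>?t. real n * (1 / real n ^ q * (1 / real n ^ q)) else 0)"
    by (intro sum.cong refl) (simp add: finite_tuples cong: sum.cong)
  also have "\<dots> = real n"
    using n by (simp add: finite_tuples card_tuples cong: sum.cong)
  also have "(\<Sum>a\<in>?t. \<Sum>b\<in>?t. \<Sum>c\<in>?t. \<Sum>d\<in>?t.
        Ttilde n Y a b c d * (mon x a * mon x b * mon x c * mon x d))
      = real n ^ (l - 2 * q) * (\<Sum>S\<in>?I. \<Sum>T\<in>?I. Mmat n q l Y S T * mon x S * mon x T)"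
    using n by (simp add: Mmat_quadratic_form[OF x N])
  also have "\<dots> \<le> real n ^ (l - 2 * q) * op_norm ?I (Mmat n q l Y)"
    using sum_mon_square[OF x n, of l]
    by (intro mult_left_mono quadratic_form_le_op_norm) (auto simp: power2_eq_square)
  finally show ?thesis by (simp add: mult_2 add.assoc)
qed

section \<open>The Kikuchi matrix as a paired chaos\<close>

type_synonym chaos_index = "nat list \<times> nat list \<times> nat list \<times> nat list \<times> nat"

text \<open>The inequality removes products of a sign with itself, so each term has two distinct
  variables. They share the last index, which is the colour.\<close>

definition steps :: "nat \<Rightarrow> nat \<Rightarrow> chaos_index set" where
  "steps n q = {(a, b, c, d, e). a \<in> tuples n q \<and> b \<in> tuples n q \<and> c \<in> tuples n q \<and> d \<in> tuples n q
      \<and> e < n \<and> a @ c \<noteq> b @ d}"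

fun var1 :: "chaos_index \<Rightarrow> nat list" where
  "var1 (a, b, c, d, e) = a @ c @ [e]"

fun var2 :: "chaos_index \<Rightarrow> nat list" where
  "var2 (a, b, c, d, e) = b @ d @ [e]"

fun link_weight :: "nat \<Rightarrow> nat \<Rightarrow> chaos_index \<Rightarrow> nat list \<Rightarrow> nat list \<Rightarrow> real" where
  "link_weight n l (a, b, c, d, e) S T = (if linked l a b c d S T then 1 / Ncount n l a b c d else 0)"

lemma finite_steps: "finite (steps n q)"
  by (rule finite_subset[of _ "tuples n q \<times> tuples n q \<times> tuples n q \<times> tuples n q \<times> {..<n}"])
    (auto simp: steps_def finite_tuples)

lemma steps_vars:
  assumes "j \<in> steps n q"
  shows "var1 j \<in> tuples n (2 * q + 1)" "var2 j \<in> tuples n (2 * q + 1)" "var1 j \<noteq> var2 j"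
    "last (var1 j) < n" "last (var2 j) = last (var1 j)"
proof -
  obtain a b c d e where j: "j = (a, b, c, d, e)" by (cases j)
  with assms have *: "a \<in> tuples n q" "b \<in> tuples n q" "c \<in> tuples n q" "d \<in> tuples n q" "e < n" "a @ c \<noteq> b @ d"
    by (auto simp: steps_def)
  have "[e] \<in> tuples n 1" using *(5) by (simp add: tuples_def)
  with * show "var1 j \<in> tuples n (2 * q + 1)" "var2 j \<in> tuples n (2 * q + 1)"
    unfolding j var1.simps var2.simps mult_2 add.assoc by (blast intro: append_in_tuples)+
  show "var1 j \<noteq> var2 j" "last (var1 j) < n" "last (var2 j) = last (var1 j)"
    using * by (simp_all add: j flip: append_assoc)
qed

lemma Mmat_eq_sum_steps:
  "Mmat n q l Y S T = (\<Sum>j\<in>steps n q. Y (var1 j) * Y (var2 j) * link_weight n l j S T)"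
proof -
  let ?t = "tuples n q"
  let ?f = "\<lambda>a b c d e. Y (a @ c @ [e]) * Y (b @ d @ [e]) * link_weight n l (a, b, c, d, e) S T"
  have "Mmat n q l Y S T = (\<Sum>a\<in>?t. \<Sum>b\<in>?t. \<Sum>c\<in>?t. \<Sum>d\<in>?t. \<Sum>e<n. if a @ c \<noteq> b @ d then ?f a b c d e else 0)"
    unfolding Mmat_def
    by (intro sum.cong refl) (simp add: Ttilde_def Tt_def sum_distrib_right sum_divide_distrib)
  also have "\<dots> = (\<Sum>j\<in>?t \<times> ?t \<times> ?t \<times> ?t \<times> {..<n}.
      if j \<in> {(a, b, c, d, e). a @ c \<noteq> b @ d} then Y (var1 j) * Y (var2 j) * link_weight n l j S T else 0)"
    unfolding sum.cartesian_product by (intro sum.cong refl) (clarsimp simp del: link_weight.simps)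
  also have "\<dots> = (\<Sum>j\<in>(?t \<times> ?t \<times> ?t \<times> ?t \<times> {..<n}) \<inter> {(a, b, c, d, e). a @ c \<noteq> b @ d}.
      Y (var1 j) * Y (var2 j) * link_weight n l j S T)"
    by (rule sum.inter_restrict[symmetric]) (simp add: finite_tuples)
  also have "(?t \<times> ?t \<times> ?t \<times> ?t \<times> {..<n}) \<inter> {(a, b, c, d, e). a @ c \<noteq> b @ d} = steps n q"
    by (auto simp: steps_def)
  finally show ?thesis .
qed

text \<open>The pairs of a term and a target that a fixed source \<open>S\<close> can reach, for one
  of the two orientations in \<open>linked\<close>; the primed version treats the other.\<close>

definition links :: "nat \<Rightarrow> nat \<Rightarrow> nat list \<Rightarrow> chaos_index set \<Rightarrow> (chaos_index \<times> nat list) set" where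
  "links n l S J = {(j, T). j \<in> J \<and> T \<in> tuples n l \<and> (case j of (a, b, c, d, e) \<Rightarrow> link_dir l (a @ b) (c @ d) S T)}"

definition links' :: "nat \<Rightarrow> nat \<Rightarrow> nat list \<Rightarrow> chaos_index set \<Rightarrow> (chaos_index \<times> nat list) set" where
  "links' n l S J = {(j, T). j \<in> J \<and> T \<in> tuples n l \<and> (case j of (a, b, c, d, e) \<Rightarrow> link_dir l (c @ d) (a @ b) S T)}"

text \<open>Each nonzero entry is at most 1 / \<open>N\<^sub>0\<close>, and the nonzero entries are
  counted once per orientation, whence the factor 2.\<close>

lemma sum_link_weight_le:
  assumes J: "J \<subseteq> steps n q" and N0: "N\<^sub>0 > 0"
    and N: "\<And>a b c d. \<lbrakk>a \<in> tuples n q; b \<in> tuples n q; c \<in> tuples n q; d \<in> tuples n q\<rbrakk>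
      \<Longrightarrow> N\<^sub>0 \<le> real (Ncount n l a b c d)"
    and m: "card (links n l S J) \<le> m" "card (links' n l S J) \<le> m"
  shows "(\<Sum>j\<in>J. \<Sum>T\<in>tuples n l. link_weight n l j S T) \<le> 2 / N\<^sub>0 * m"
proof -
  have finJ: "finite J" using J finite_steps finite_subset by blast
  let ?X = "links n l S J \<union> links' n l S J"
  have "(\<Sum>j\<in>J. \<Sum>T\<in>tuples n l. link_weight n l j S T)
      \<le> (\<Sum>w\<in>J \<times> tuples n l. if w \<in> ?X then 1 / N\<^sub>0 else 0)"
    unfolding sum.cartesian_product
  proof (rule sum_mono, clarify)
    fix a b c d e T assume w: "(a, b, c, d, e) \<in> J" "T \<in> tuples n l"
    then have "1 / real (Ncount n l a b c d) \<le> 1 / N\<^sub>0"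
      using J N0 by (intro divide_left_mono N mult_pos_pos less_le_trans[OF N0 N]) (auto simp: steps_def)
    with w N0 show "link_weight n l (a, b, c, d, e) S T \<le> (if ((a, b, c, d, e), T) \<in> ?X then 1 / N\<^sub>0 else 0)"
      by (auto simp: links_def links'_def linked_def)
  qed
  also have "\<dots> = (\<Sum>w\<in>(J \<times> tuples n l) \<inter> ?X. 1 / N\<^sub>0)"
    using finJ by (intro sum.inter_restrict[symmetric]) (simp add: finite_tuples)
  also have "(J \<times> tuples n l) \<inter> ?X = ?X"
    by (auto simp: links_def links'_def)
  also have "(\<Sum>w\<in>?X. 1 / N\<^sub>0) = card ?X / N\<^sub>0" by simp
  also have "\<dots> \<le> 2 * m / N\<^sub>0"
    using N0 m card_Un_le[of "links n l S J" "links' n l S J"] by (intro divide_right_mono) auto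
  finally show ?thesis by simp
qed

section \<open>Counting the links that leave a fixed tuple\<close>

lemma card_le_links:
  assumes "inj_on g X" "length u1 = m1" "length v1 = m1" "length S = l"
    and "g ` X \<subseteq> {(u2, v2, T). u2 \<in> tuples n m2 \<and> v2 \<in> tuples n m2 \<and> T \<in> tuples n l
            \<and> link_dir l (u1 @ u2) (v1 @ v2) S T}"
  shows "card X \<le> (m1 + m2) ^ m1 * l ^ m2 * n ^ m2"
proof -
  have "finite {(u2, v2, T). u2 \<in> tuples n m2 \<and> v2 \<in> tuples n m2 \<and> T \<in> tuples n l
            \<and> link_dir l (u1 @ u2) (v1 @ v2) S T}"
    by (rule finite_subset[of _ "tuples n m2 \<times> tuples n m2 \<times> tuples n l"]) (auto simp: finite_tuples)
  from card_inj_on_le[OF assms(1,5) this] show ?thesis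
    using card_link_dir_le[OF assms(2-4), of n m2] by simp
qed

lemma link_dir_swap_iff:
  assumes "length a = q" "length b = q" "length c = q" "length d = q"
  shows "link_dir l (a @ b) (c @ d) S T \<longleftrightarrow> link_dir l (b @ a) (d @ c) S T"
  using assms link_dir_append_swap[of c a d b] link_dir_append_swap[of d b c a] by metis

text \<open>No part of the tuples is prescribed, so the prefix is empty. The colour is fixed, which
  makes it harmless that the encoding forgets it.\<close>

lemma card_links_open_open:
  assumes S: "S \<in> tuples n l" and J: "J \<subseteq> steps n q" and e: "\<And>j. j \<in> J \<Longrightarrow> last (var1 j) = e"
  shows "card (links n l S J) \<le> l ^ (2 * q) * n ^ (2 * q)" "card (links' n l S J) \<le> l ^ (2 * q) * n ^ (2 * q)"
proof -
  have len: "length S = l" using S by (simp add: tuples_def)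
  have J': "length a = q \<and> length b = q \<and> length c = q \<and> length d = q \<and> e' = e
      \<and> a @ b \<in> tuples n (2 * q) \<and> c @ d \<in> tuples n (2 * q)" if "(a, b, c, d, e') \<in> J" for a b c d e'
    using that J e[OF that] append_in_tuples[of a n q b q] append_in_tuples[of c n q d q]
    by (auto simp: steps_def mult_2 length_tuples)
  let ?g = "\<lambda>((a, b, c, d, e), T). (a @ b, c @ d, T)"
  let ?h = "\<lambda>((a, b, c, d, e), T). (c @ d, a @ b, T)"
  have "card (links n l S J) \<le> (0 + 2 * q) ^ 0 * l ^ (2 * q) * n ^ (2 * q)"
  proof (rule card_le_links[where g = ?g and ?u1.0 = "[] :: nat list" and ?v1.0 = "[] :: nat list"])
    show "inj_on ?g (links n l S J)"
      by (rule inj_on_inverseI[where g = "\<lambda>(u, v, T). ((take q u, drop q u, take q v, drop q v, e), T)"])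
        (auto simp: links_def dest: J')
    show "?g ` links n l S J \<subseteq> {(u2, v2, T). u2 \<in> tuples n (2 * q) \<and> v2 \<in> tuples n (2 * q) \<and> T \<in> tuples n l
            \<and> link_dir l ([] @ u2) ([] @ v2) S T}"
      by (auto simp: links_def dest: J')
  qed (use len in simp_all)
  then show "card (links n l S J) \<le> l ^ (2 * q) * n ^ (2 * q)" by simp
  have "card (links' n l S J) \<le> (0 + 2 * q) ^ 0 * l ^ (2 * q) * n ^ (2 * q)"
  proof (rule card_le_links[where g = ?h and ?u1.0 = "[] :: nat list" and ?v1.0 = "[] :: nat list"])
    show "inj_on ?h (links' n l S J)"
      by (rule inj_on_inverseI[where g = "\<lambda>(v, u, T). ((take q u, drop q u, take q v, drop q v, e), T)"])
        (auto simp: links'_def dest: J')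
    show "?h ` links' n l S J \<subseteq> {(u2, v2, T). u2 \<in> tuples n (2 * q) \<and> v2 \<in> tuples n (2 * q) \<and> T \<in> tuples n l
            \<and> link_dir l ([] @ u2) ([] @ v2) S T}"
      by (auto simp: links'_def dest: J')
  qed (use len in simp_all)
  then show "card (links' n l S J) \<le> l ^ (2 * q) * n ^ (2 * q)" by simp
qed

lemma var_components:
  assumes "a \<in> tuples n q" "c \<in> tuples n q" "a @ c @ [e] = v"
  shows "a = take q v" "c = take q (drop q v)" "e = last v"
  using assms by (auto simp: tuples_def)

text \<open>A prescribed \<open>var1\<close> fixes \<open>a\<close> and \<open>c\<close>, that is,
  the first half of both sides of the link. Each position of that half has at most 2q candidates,
  while the other half keeps (l n)^q choices of positions and new values.\<close>

lemma card_links_close_open: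
  assumes S: "S \<in> tuples n l" and J: "J \<subseteq> steps n q" and v: "\<And>j. j \<in> J \<Longrightarrow> var1 j = v"
  shows "card (links n l S J) \<le> (2 * q) ^ q * l ^ q * n ^ q" "card (links' n l S J) \<le> (2 * q) ^ q * l ^ q * n ^ q"
proof -
  have len: "length S = l" using S by (simp add: tuples_def)
  define a0 c0 where "a0 = take q v" and "c0 = take q (drop q v)"
  have J': "a = a0 \<and> c = c0 \<and> e = last v \<and> a \<in> tuples n q \<and> b \<in> tuples n q \<and> c \<in> tuples n q \<and> d \<in> tuples n q"
    if "(a, b, c, d, e) \<in> J" for a b c d e
    using that J v[OF that] var_components[of a n q c e v] by (auto simp: a0_def c0_def steps_def)
  let ?g = "\<lambda>((a, b, c, d, e), T). (b, d, T)"
  let ?h = "\<lambda>((a, b, c, d, e), T). (d, b, T)"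
  show "card (links n l S J) \<le> (2 * q) ^ q * l ^ q * n ^ q"
  proof (cases "J = {}")
    case False
    then have len0: "length a0 = q" "length c0 = q" using J' by (force simp: tuples_def)+
    have "card (links n l S J) \<le> (q + q) ^ q * l ^ q * n ^ q"
    proof (rule card_le_links[where g = ?g and ?u1.0 = a0 and ?v1.0 = c0])
      show "inj_on ?g (links n l S J)"
        by (rule inj_on_inverseI[where g = "\<lambda>(b, d, T). ((a0, b, c0, d, last v), T)"])
          (auto simp: links_def dest!: J')
      show "?g ` links n l S J \<subseteq> {(u2, v2, T). u2 \<in> tuples n q \<and> v2 \<in> tuples n q \<and> T \<in> tuples n l
              \<and> link_dir l (a0 @ u2) (c0 @ v2) S T}"
        by (auto simp: links_def dest!: J')
    qed (use len len0 in simp_all)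
    then show ?thesis by (simp add: mult_2)
  qed (simp add: links_def)
  show "card (links' n l S J) \<le> (2 * q) ^ q * l ^ q * n ^ q"
  proof (cases "J = {}")
    case False
    then have len0: "length a0 = q" "length c0 = q" using J' by (force simp: tuples_def)+
    have "card (links' n l S J) \<le> (q + q) ^ q * l ^ q * n ^ q"
    proof (rule card_le_links[where g = ?h and ?u1.0 = c0 and ?v1.0 = a0])
      show "inj_on ?h (links' n l S J)"
        by (rule inj_on_inverseI[where g = "\<lambda>(d, b, T). ((a0, b, c0, d, last v), T)"])
          (auto simp: links'_def dest!: J')
      show "?h ` links' n l S J \<subseteq> {(u2, v2, T). u2 \<in> tuples n q \<and> v2 \<in> tuples n q \<and> T \<in> tuples n l
              \<and> link_dir l (c0 @ u2) (a0 @ v2) S T}"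
        by (auto simp: links'_def dest!: J')
    qed (use len len0 in simp_all)
    then show ?thesis by (simp add: mult_2)
  qed (simp add: links'_def)
qed

text \<open>Exchanging (a, c) with (b, d) turns \<open>var2\<close> into \<open>var1\<close> and
  only permutes the blocks of the link, so the previous count applies.\<close>

lemma card_links_open_close:
  assumes S: "S \<in> tuples n l" and J: "J \<subseteq> steps n q" and v: "\<And>j. j \<in> J \<Longrightarrow> var2 j = v"
  shows "card (links n l S J) \<le> (2 * q) ^ q * l ^ q * n ^ q" "card (links' n l S J) \<le> (2 * q) ^ q * l ^ q * n ^ q"
proof -
  define sw :: "chaos_index \<Rightarrow> chaos_index" where "sw = (\<lambda>(a, b, c, d, e). (b, a, d, c, e))"
  have inj: "inj_on (map_prod sw id) X" for X :: "(chaos_index \<times> nat list) set"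
    by (auto simp: inj_on_def sw_def)
  have J': "sw ` J \<subseteq> steps n q" "\<And>j. j \<in> sw ` J \<Longrightarrow> var1 j = v"
    using J v by (fastforce simp: sw_def steps_def)+
  have fin: "finite (links n l S (sw ` J))" "finite (links' n l S (sw ` J))"
    by (rule finite_subset[of _ "steps n q \<times> tuples n l"],
        use J'(1) in \<open>force simp: links_def links'_def\<close>, simp add: finite_tuples finite_steps)+
  have J_len: "length a = q \<and> length b = q \<and> length c = q \<and> length d = q" if "(a, b, c, d, e) \<in> J" for a b c d e
    using that J by (auto simp: steps_def tuples_def)
  have "map_prod sw id ` links n l S J \<subseteq> links n l S (sw ` J)"
  proof (rule image_subsetI)
    fix z assume "z \<in> links n l S J"
    moreover obtain a b c d e T where "z = ((a, b, c, d, e), T)" by (metis prod.exhaust)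
    ultimately show "map_prod sw id z \<in> links n l S (sw ` J)"
      using J_len[of a b c d e] link_dir_swap_iff[of a q b c d l S T]
      by (force simp: links_def sw_def)
  qed
  from card_inj_on_le[OF inj this fin(1)]
  show "card (links n l S J) \<le> (2 * q) ^ q * l ^ q * n ^ q"
    using card_links_close_open(1)[OF S J'] by simp
  have "map_prod sw id ` links' n l S J \<subseteq> links' n l S (sw ` J)"
  proof (rule image_subsetI)
    fix z assume "z \<in> links' n l S J"
    moreover obtain a b c d e T where "z = ((a, b, c, d, e), T)" by (metis prod.exhaust)
    ultimately show "map_prod sw id z \<in> links' n l S (sw ` J)"
      using J_len[of a b c d e] link_dir_swap_iff[of c q d a b l S T]
      by (force simp: links'_def sw_def)
  qed
  from card_inj_on_le[OF inj this fin(2)]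
  show "card (links' n l S J) \<le> (2 * q) ^ q * l ^ q * n ^ q"
    using card_links_close_open(2)[OF S J'] by simp
qed

text \<open>The two variables determine the whole term; what remains is to place 2q prescribed
  entries, with at most 2q candidate positions for each.\<close>

lemma card_links_close_close:
  assumes S: "S \<in> tuples n l" and J: "J \<subseteq> steps n q"
    and v: "\<And>j. j \<in> J \<Longrightarrow> var1 j = v" "\<And>j. j \<in> J \<Longrightarrow> var2 j = w"
  shows "card (links n l S J) \<le> (2 * q) ^ (2 * q)" "card (links' n l S J) \<le> (2 * q) ^ (2 * q)"
proof -
  have len: "length S = l" using S by (simp add: tuples_def)
  define u0 v0 where "u0 = take q v @ take q w" and "v0 = take q (drop q v) @ take q (drop q w)"
  define j0 where "j0 = (take q v, take q w, take q (drop q v), take q (drop q w), last v)"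
  have J': "j = j0 \<and> length u0 = 2 * q \<and> length v0 = 2 * q" if "j \<in> J" for j
  proof -
    obtain a b c d e where j: "j = (a, b, c, d, e)" by (cases j)
    have t: "a \<in> tuples n q" "b \<in> tuples n q" "c \<in> tuples n q" "d \<in> tuples n q"
      using that J by (auto simp: steps_def j)
    have "a @ c @ [e] = v" "b @ d @ [e] = w" using v[OF that] by (simp_all add: j)
    from var_components[OF t(1,3) this(1)] var_components[OF t(2,4) this(2)] show ?thesis
      using length_tuples[OF t(1)] length_tuples[OF t(2)] length_tuples[OF t(3)] length_tuples[OF t(4)]
      by (simp add: j j0_def u0_def v0_def)
  qed
  have len0: "length u0 = 2 * q" "length v0 = 2 * q" if "J \<noteq> {}"
    using that J' by auto
  show "card (links n l S J) \<le> (2 * q) ^ (2 * q)"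
  proof (cases "J = {}")
    case False
    have sub: "fst z = j0" "snd z \<in> tuples n l" "link_dir l u0 v0 S (snd z)" if "z \<in> links n l S J" for z
      using that J' by (auto simp: links_def j0_def u0_def v0_def)
    have "card (links n l S J) \<le> (2 * q + 0) ^ (2 * q) * l ^ 0 * n ^ 0"
    proof (rule card_le_links[where g = "\<lambda>z. ([], [], snd z)" and ?u1.0 = u0 and ?v1.0 = v0])
      show "inj_on (\<lambda>z. ([], [], snd z)) (links n l S J)"
        by (rule inj_on_inverseI[where g = "\<lambda>(_, _, T). (j0, T)"]) (simp add: prod_eq_iff sub(1))
    qed (use sub(2,3) len len0[OF False] in \<open>auto simp: tuples_def[of n 0]\<close>)
    then show ?thesis by simp
  qed (simp add: links_def)
  show "card (links' n l S J) \<le> (2 * q) ^ (2 * q)"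
  proof (cases "J = {}")
    case False
    have sub: "fst z = j0" "snd z \<in> tuples n l" "link_dir l v0 u0 S (snd z)" if "z \<in> links' n l S J" for z
      using that J' by (auto simp: links'_def j0_def u0_def v0_def)
    have "card (links' n l S J) \<le> (2 * q + 0) ^ (2 * q) * l ^ 0 * n ^ 0"
    proof (rule card_le_links[where g = "\<lambda>z. ([], [], snd z)" and ?u1.0 = v0 and ?v1.0 = u0])
      show "inj_on (\<lambda>z. ([], [], snd z)) (links' n l S J)"
        by (rule inj_on_inverseI[where g = "\<lambda>(_, _, T). (j0, T)"]) (simp add: prod_eq_iff sub(1))
    qed (use sub(2,3) len len0[OF False] in \<open>auto simp: tuples_def[of n 0]\<close>)
    then show ?thesis by simp
  qed (simp add: links'_def)
qed

text \<open>The four counts factor per variable: an open one costs (l n)^q and a closed one (2q)^q.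
  The scale \<open>2 / N\<^sub>0\<close> gathers the two orientations and the lower bound on the
  normalisation.\<close>

lemma paired_chaos_Mmat:
  assumes q: "q > 0" and l: "l > 0" and n: "n > 0" and N0: "N\<^sub>0 > 0"
    and N: "\<And>a b c d. \<lbrakk>a \<in> tuples n q; b \<in> tuples n q; c \<in> tuples n q; d \<in> tuples n q\<rbrakk>
      \<Longrightarrow> N\<^sub>0 \<le> real (Ncount n l a b c d)"
  shows "paired_chaos (tuples n (2 * q + 1)) last {..<n} (steps n q) var1 var2 (link_weight n l) (tuples n l)
    (2 / N\<^sub>0) (real l ^ q * real n ^ q) (real (2 * q) ^ q)"
proof unfold_locales
  show "var1 j \<in> tuples n (2 * q + 1)" "var2 j \<in> tuples n (2 * q + 1)" "last (var1 j) \<in> {..<n}"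
    "last (var2 j) = last (var1 j)" "var1 j \<noteq> var2 j"
    if "j \<in> steps n q" for j
    using steps_vars[OF that] by simp_all
  show "link_weight n l j s t \<ge> 0" for j s t
    by (cases j) auto
  fix s assume s: "s \<in> tuples n l"
  have le: "(\<Sum>j\<in>J. \<Sum>t\<in>tuples n l. link_weight n l j s t) \<le> 2 / N\<^sub>0 * m"
    if "J \<subseteq> steps n q" "card (links n l s J) \<le> m" "card (links' n l s J) \<le> m" for J m
    using sum_link_weight_le[OF that(1) N0 _ that(2,3)] N by blast
  show "(\<Sum>j | j \<in> steps n q \<and> last (var1 j) = e. \<Sum>t\<in>tuples n l. link_weight n l j s t)
      \<le> 2 / N\<^sub>0 * (real l ^ q * real n ^ q)\<^sup>2" for e
  proof -
    let ?J = "{j \<in> steps n q. last (var1 j) = e}"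
    have "card (links n l s ?J) \<le> l ^ (2 * q) * n ^ (2 * q)" "card (links' n l s ?J) \<le> l ^ (2 * q) * n ^ (2 * q)"
      by (rule card_links_open_open[OF s]; auto)+
    from le[OF _ this] show ?thesis
      by (simp add: power_mult_distrib power_mult[symmetric] mult_ac)
  qed
  show "(\<Sum>j | j \<in> steps n q \<and> var1 j = v. \<Sum>t\<in>tuples n l. link_weight n l j s t)
      \<le> 2 / N\<^sub>0 * (real l ^ q * real n ^ q * real (2 * q) ^ q)" for v
  proof -
    let ?J = "{j \<in> steps n q. var1 j = v}"
    have "card (links n l s ?J) \<le> (2 * q) ^ q * l ^ q * n ^ q" "card (links' n l s ?J) \<le> (2 * q) ^ q * l ^ q * n ^ q"
      by (rule card_links_close_open[OF s]; auto)+
    from le[OF _ this] show ?thesis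
      by (simp add: power_mult_distrib power_mult[symmetric] mult_ac)
  qed
  show "(\<Sum>j | j \<in> steps n q \<and> var2 j = v. \<Sum>t\<in>tuples n l. link_weight n l j s t)
      \<le> 2 / N\<^sub>0 * (real l ^ q * real n ^ q * real (2 * q) ^ q)" for v
  proof -
    let ?J = "{j \<in> steps n q. var2 j = v}"
    have "card (links n l s ?J) \<le> (2 * q) ^ q * l ^ q * n ^ q" "card (links' n l s ?J) \<le> (2 * q) ^ q * l ^ q * n ^ q"
      by (rule card_links_open_close[OF s]; auto)+
    from le[OF _ this] show ?thesis
      by (simp add: power_mult_distrib power_mult[symmetric] mult_ac)
  qed
  show "(\<Sum>j | j \<in> steps n q \<and> var1 j = v \<and> var2 j = w. \<Sum>t\<in>tuples n l. link_weight n l j s t)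
      \<le> 2 / N\<^sub>0 * (real (2 * q) ^ q)\<^sup>2" for v w
  proof -
    let ?J = "{j \<in> steps n q. var1 j = v \<and> var2 j = w}"
    have "card (links n l s ?J) \<le> (2 * q) ^ (2 * q)" "card (links' n l s ?J) \<le> (2 * q) ^ (2 * q)"
      by (rule card_links_close_close[OF s]; auto)+
    from le[OF _ this] show ?thesis
      by (simp add: power_mult_distrib power_mult[symmetric] mult_ac)
  qed
qed (use q l n N0 in \<open>simp_all add: finite_tuples finite_steps\<close>)

section \<open>The certificate\<close>

text \<open>Excluding 4q values costs at most a factor 2: by Bernoulli's inequality (1 - 4q/n)^(l -
  2q) is at least 1 - 4 q l / n, and l \<le> n / (8q) makes this at least 1/2.\<close>

lemma Ncount_ge_real:
  assumes q: "q > 0" and l: "2 * q \<le> l" and n: "real l \<le> real n / (4 * real (2 * q))"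
    and t: "a \<in> tuples n q" "b \<in> tuples n q" "c \<in> tuples n q" "d \<in> tuples n q"
  shows "(real l / real (2 * q)) ^ (2 * q) * real n ^ (l - 2 * q) / 2 \<le> real (Ncount n l a b c d)"
proof -
  have nl: "8 * real q * real l \<le> real n" using n q by (simp add: field_simps)
  have "1 * real l \<le> real l * real l" using l q by (intro mult_right_mono) auto
  have "real q \<ge> 1" "real l \<ge> 2" using q l by auto
  then have "1 * 2 \<le> real q * real l" by (intro mult_mono) auto
  then have npos: "real n > 0" using nl by linarith
  have "4 * real q * 1 \<le> 4 * real q * real l" using \<open>real l \<ge> 2\<close> by (intro mult_left_mono) auto
  then have qn: "4 * real q \<le> real n" using nl \<open>1 * 2 \<le> real q * real l\<close> by linarith
  have "real n ^ (l - 2 * q) / 2 \<le> (real n - 4 * real q) ^ (l - 2 * q)"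
  proof -
    have "real (l - 2 * q) * (4 * real q) \<le> real l * (4 * real q)"
      by (intro mult_right_mono) auto
    also have "\<dots> \<le> real n / 2" using nl by (simp add: algebra_simps)
    finally have "1 / 2 \<le> 1 + real (l - 2 * q) * (- (4 * real q / real n))"
      using npos by (simp add: field_simps)
    also have "\<dots> \<le> (1 + (- (4 * real q / real n))) ^ (l - 2 * q)"
      using qn npos by (intro Bernoulli_inequality) (simp add: field_simps)
    finally have "real n ^ (l - 2 * q) * (1 / 2) \<le> real n ^ (l - 2 * q) * (1 + (- (4 * real q / real n))) ^ (l - 2 * q)"
      by (intro mult_left_mono) auto
    also have "\<dots> = (real n - 4 * real q) ^ (l - 2 * q)"
      using npos by (simp add: algebra_simps flip: power_mult_distrib)
    finally show ?thesis by simp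
  qed
  moreover have "(real l / real (2 * q)) ^ (2 * q) \<le> real (l choose (2 * q))"
    using l by (rule binomial_ge_n_over_k_pow_k)
  ultimately have "(real l / real (2 * q)) ^ (2 * q) * (real n ^ (l - 2 * q) / 2)
      \<le> real (l choose (2 * q)) * (real n - 4 * real q) ^ (l - 2 * q)"
    by (intro mult_mono) auto
  also have "\<dots> = real ((l choose (2 * q)) * (n - 4 * q) ^ (l - 2 * q))"
    using qn by (simp add: of_nat_diff)
  also have "\<dots> \<le> real (Ncount n l a b c d)"
    using Ncount_ge[OF t, of l] by (simp only: of_nat_le_iff)
  finally show ?thesis by simp
qed

lemma Mmat_sym: "Mmat n q l Y S T = Mmat n q l Y T S"
  unfolding Mmat_def
  by (intro sum.cong refl arg_cong2[where f = "(*)"] if_cong linked_sym) (simp add: length_tuples)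

lemma rad_tensors_eq: "rad_tensors n p = sign_vectors (tuples n p)"
  by (simp add: rad_tensors_def sign_vectors_def)

text \<open>The threshold is at least 3 times the rate per step, and 3 exceeds e. Over 2k \<ge> 2 l
  ln n steps this gains a factor n^(-2l).\<close>

lemma prob_op_norm_Mmat:
  assumes q: "q > 0" and l: "2 * q \<le> l" and n1: "real l \<le> real n / (4 * real (2 * q))"
    and n2: "real l \<le> real n / (8 * ln (real n))"
    and \<tau>: "\<tau> = 300 * real (2 * q) ^ (3 * q) * sqrt (real l * ln (real n) * real n) * real n ^ (3 * q)
                / (real l ^ q * real n ^ l)"
  shows "measure_pmf.prob (pmf_of_set (rad_tensors n (2 * q + 1)))
      {Y. op_norm (tuples n l) (Mmat n q l Y) \<le> \<tau>} \<ge> 1 - 1 / real n ^ l"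
proof -
  have l2: "real l \<ge> 2" using q l by simp
  have nl: "8 * real q * real l \<le> real n" using n1 q by (simp add: field_simps)
  have "1 * 2 \<le> real q * real l" using q l2 by (intro mult_mono) auto
  then have n16: "real n \<ge> 16" using nl by linarith
  have "exp 1 \<le> real n" using n16 exp_le by linarith
  then have ln1: "ln (real n) \<ge> 1" using n16 by (subst ln_ge_iff) auto
  define X where "X = real l * ln (real n)"
  have "2 * 1 \<le> X" unfolding X_def using l2 ln1 by (intro mult_mono) auto
  then have X2: "X \<ge> 2" by simp
  \<comment> \<open>The hypothesis l \<le> n / (8 ln n) enters here: \<open>rate_le\<close> needs X
    to be at most the number n of colours.\<close>
  have "8 * X \<le> real n" using n2 ln1 by (simp add: X_def field_simps)
  then have Xn: "X \<le> real n" using X2 by linarith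
  \<comment> \<open>As X is at least 2, rounding up keeps 2k \<le> 2X + 2 \<le> 3X, as
    \<open>rate_le\<close> requires.\<close>
  define k where "k = nat \<lceil>X\<rceil>"
  have k: "k > 0" "X \<le> real k" "real k \<le> X + 1" using X2 unfolding k_def by linarith+
  define N\<^sub>0 where "N\<^sub>0 = (real l / real (2 * q)) ^ (2 * q) * real n ^ (l - 2 * q) / 2"
  have N0: "N\<^sub>0 > 0" using l2 n16 q by (simp add: N\<^sub>0_def)
  define R where "R = sign_vectors (tuples n (2 * q + 1))"
  interpret M: paired_chaos "tuples n (2 * q + 1)" last "{..<n}" "steps n q" var1 var2 "link_weight n l" "tuples n l"
    "2 / N\<^sub>0" "real l ^ q * real n ^ q" "real (2 * q) ^ q"
    using q l2 n16 N0 Ncount_ge_real[OF q l n1] by (intro paired_chaos_Mmat) (auto simp: N\<^sub>0_def)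
  have chaos: "M.chaos Y S T = Mmat n q l Y S T" for Y S T
    by (simp add: M.chaos_def Mmat_eq_sum_steps)
  obtain \<sigma> where \<sigma>: "\<sigma> > 0" and rate: "M.rate \<sigma> (2 * k)
      \<le> 25 * (2 / N\<^sub>0) * (real l ^ q * real n ^ q) * real (2 * q) ^ q * sqrt (X * real n)"
    using M.rate_le[of X "2 * k"] k X2 Xn by auto
  have \<tau>_pos: "\<tau> > 0" using l2 n16 q X2 ln1 by (simp add: \<tau>)
  \<comment> \<open>The constant is 25 times 2 times another 2 from the halving in
    \<open>N\<^sub>0\<close>, that is, 100 = 300 / 3.\<close>
  have "25 * (2 / N\<^sub>0) * (real l ^ q * real n ^ q) * real (2 * q) ^ q * sqrt (X * real n) = \<tau> / 3"
  proof -
    have "real n ^ l = real n ^ (l - 2 * q) * real n ^ (2 * q)"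
      using l by (simp flip: power_add)
    moreover have "z ^ (3 * q) = z ^ q * z ^ (2 * q)" for z :: real
      by (simp flip: power_add)
    moreover have "real l ^ (2 * q) = real l ^ q * real l ^ q"
      by (simp add: mult_2 power_add)
    ultimately show ?thesis
      using q l2 n16 unfolding \<tau> N\<^sub>0_def X_def power_divide by (simp add: field_simps)
  qed
  with rate exp_le \<tau>_pos have "M.rate \<sigma> (2 * k) \<le> \<tau> / 3" by simp
  also have "\<dots> \<le> \<tau> / exp 1" using exp_le \<tau>_pos by (intro divide_left_mono) auto
  finally have "M.rate \<sigma> (2 * k) ^ (2 * k) \<le> (\<tau> / exp 1) ^ (2 * k)"
    by (intro power_mono M.rate_nonneg)
  also have "\<dots> = \<tau> ^ (2 * k) / exp (2 * real k)"
    by (simp add: power_divide flip: exp_of_nat_mult)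
  also have "\<dots> \<le> \<tau> ^ (2 * k) / exp (2 * X)"
    using k \<tau>_pos by (intro divide_left_mono) auto
  \<comment> \<open>One factor n^l pays for the dimension in the trace, the other becomes the
    failure probability.\<close>
  also have "exp (2 * X) = real n ^ l * real n ^ l"
    using n16 by (simp add: X_def exp_double exp_of_nat_mult power2_eq_square)
  finally have rate_pow: "M.rate \<sigma> (2 * k) ^ (2 * k) \<le> \<tau> ^ (2 * k) / (real n ^ l * real n ^ l)" .
  let ?bad = "{Y \<in> R. op_norm (tuples n l) (Mmat n q l Y) > \<tau>}"
  have "card ?bad * \<tau> ^ (2 * k) \<le> card R * card (tuples n l) * M.rate \<sigma> (2 * k) ^ (2 * k)"
    using M.card_large_op_norm_le[OF _ k(1) \<tau>_pos \<sigma>] Mmat_sym by (simp add: chaos R_def ext[OF ext[OF chaos]])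
  also have "\<dots> \<le> card R * real n ^ l * (\<tau> ^ (2 * k) / (real n ^ l * real n ^ l))"
    using mult_left_mono[OF rate_pow, of "card R * real n ^ l"] by (simp only: card_tuples of_nat_mult of_nat_power) simp
  also have "\<dots> = card R / real n ^ l * \<tau> ^ (2 * k)" using n16 by simp
  finally have bad: "card ?bad \<le> card R / real n ^ l"
    by (rule mult_right_le_imp_le) (simp add: \<tau>_pos)
  have finR: "finite R" by (simp add: R_def finite_sign_vectors finite_tuples)
  have neR: "R \<noteq> {}" by (simp add: R_def sign_vectors_def PiE_eq_empty_iff)
  have cardR: "real (card R) > 0" using finR neR by (simp add: card_gt_0_iff)
  let ?good = "{Y. op_norm (tuples n l) (Mmat n q l Y) \<le> \<tau>}"
  have "R - ?bad = R \<inter> ?good" by auto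
  then have "real (card (R \<inter> ?good)) = real (card R) - real (card ?bad)"
    using card_Diff_subset[of ?bad R] card_mono[OF finR, of ?bad] finR by (simp add: of_nat_diff)
  moreover have "measure_pmf.prob (pmf_of_set R) ?good = card (R \<inter> ?good) / card R"
    using finR neR by (simp add: measure_pmf_of_set)
  ultimately have "measure_pmf.prob (pmf_of_set R) ?good = 1 - card ?bad / card R"
    using cardR by (simp add: diff_divide_distrib)
  moreover have "card ?bad / card R \<le> 1 / real n ^ l"
    using bad cardR n16 by (simp add: field_simps)
  ultimately show ?thesis by (simp add: R_def rad_tensors_eq)
qed

text \<open>Subadditivity of the square root separates the diagonal contribution n. The assumption
  2q \<le> l makes the natural subtraction in the exponent exact, so its half is the stated real
  exponent.\<close>

lemma rad_inj_norm_le: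
  assumes Y: "Y \<in> rad_tensors n (2 * q + 1)" and n: "n > 0" and l: "2 * q \<le> l"
    and N: "\<And>a b c d. \<lbrakk>a \<in> tuples n q; b \<in> tuples n q; c \<in> tuples n q; d \<in> tuples n q\<rbrakk> \<Longrightarrow> Ncount n l a b c d > 0"
  shows "rad_inj_norm n (2 * q + 1) Y \<le> sqrt (real n)
    + real n powr (real l / 2 - real q) * sqrt (op_norm (tuples n l) (Mmat n q l Y))"
proof -
  let ?M = "op_norm (tuples n l) (Mmat n q l Y)"
  have bound: "\<bar>\<Sum>t\<in>tuples n (2 * q + 1). Y t * (\<Prod>i<2 * q + 1. x (t ! i))\<bar>
      \<le> sqrt (real n) + real n powr (real l / 2 - real q) * sqrt ?M"
    if x: "x \<in> flat_vectors n" for x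
  proof -
    have "(\<Sum>t\<in>tuples n (2 * q + 1). Y t * (\<Prod>i<2 * q + 1. x (t ! i)))
        = (\<Sum>t\<in>tuples n (2 * q + 1). Y t * mon x t)"
    proof (intro sum.cong refl arg_cong2[where f = "(*)"])
      fix t assume "t \<in> tuples n (2 * q + 1)"
      then show "(\<Prod>i<2 * q + 1. x (t ! i)) = mon x t"
        using prod.list_conv_set_nth[of "map x t"] by (simp add: length_tuples atLeast0LessThan)
    qed
    then have "\<bar>\<Sum>t\<in>tuples n (2 * q + 1). Y t * (\<Prod>i<2 * q + 1. x (t ! i))\<bar>
        \<le> sqrt (real n + real n ^ (l - 2 * q) * ?M)"
      using tensor_form_square_le[OF x Y n l N] by (intro real_le_rsqrt) simp
    also have "\<dots> \<le> sqrt (real n) + sqrt (real n ^ (l - 2 * q) * ?M)"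
      using op_norm_nonneg[of "tuples n l" "Mmat n q l Y"] by (intro sqrt_add_le_add_sqrt) auto
    also have "sqrt (real n ^ (l - 2 * q) * ?M) = real n powr (real l / 2 - real q) * sqrt ?M"
    proof -
      have "real n ^ (l - 2 * q) = real n powr (real l - 2 * real q)"
        using n l by (simp add: of_nat_diff flip: powr_realpow)
      then have "sqrt (real n ^ (l - 2 * q)) = real n powr (real l / 2 - real q)"
        using n by (simp add: powr_half_sqrt_powr[symmetric] diff_divide_distrib powr_powr)
      then show ?thesis by (simp add: real_sqrt_mult)
    qed
    finally show ?thesis .
  qed
  show ?thesis
    unfolding rad_inj_norm_def
  proof (rule Max.boundedI)
    show "finite ((\<lambda>x. \<bar>\<Sum>t\<in>tuples n (2 * q + 1). Y t * (\<Prod>i<2 * q + 1. x (t ! i))\<bar>) `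
          PiE {..<n} (\<lambda>_. {-1 / sqrt (real n), 1 / sqrt (real n)}))"
      by (intro finite_imageI finite_PiE) auto
    show "(\<lambda>x. \<bar>\<Sum>t\<in>tuples n (2 * q + 1). Y t * (\<Prod>i<2 * q + 1. x (t ! i))\<bar>) `
          PiE {..<n} (\<lambda>_. {-1 / sqrt (real n), 1 / sqrt (real n)}) \<noteq> {}"
      by (simp add: PiE_eq_empty_iff)
  qed (use bound in \<open>auto simp: flat_vectors_def\<close>)
qed

text \<open>Squaring turns the fractional exponents into square roots and integer powers. The
  dependence on n and l then agrees exactly on both sides, and only constants depending on p remain
  to be compared.\<close>

lemma certificate_bound:
  assumes q: "q > 0" and l: "real l \<ge> 1" and n: "real n > 1" and p: "p = 2 * q + 1"
  defines "\<tau> \<equiv> 300 * real (2 * q) ^ (3 * q) * sqrt (real l * ln (real n) * real n) * real n ^ (3 * q)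
                / (real l ^ q * real n ^ l)"
  shows "real n powr (real l / 2 - real q) * sqrt \<tau>
    \<le> 8 * real p ^ p * real l powr (1 / 2 - real p / 4) * real n powr (real p / 4) * ln (real n) powr (1 / 4)"
proof -
  have ln: "ln (real n) > 0" using n by simp
  define B where "B = real l powr (1 / 2 - real p / 4) * real n powr (real p / 4) * ln (real n) powr (1 / 4)"
  have powr2: "(z powr w)\<^sup>2 = z powr (2 * w)" for z w :: real
    by (simp add: power2_eq_square flip: powr_add)
  have l2: "(real l powr (1 / 2 - real p / 4))\<^sup>2 = sqrt (real l) / real l ^ q"
  proof -
    have "2 * (1 / 2 - real p / 4) = 1 / 2 - real q" by (simp add: p field_simps)
    then have "(real l powr (1 / 2 - real p / 4))\<^sup>2 = real l powr (1 / 2 - real q)"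
      by (simp only: powr2)
    then show ?thesis using l by (simp add: powr_diff powr_half_sqrt powr_realpow)
  qed
  have n2: "(real n powr (real p / 4))\<^sup>2 = sqrt (real n) * real n ^ q"
  proof -
    have "2 * (real p / 4) = 1 / 2 + real q" by (simp add: p field_simps)
    then have "(real n powr (real p / 4))\<^sup>2 = real n powr (1 / 2 + real q)"
      by (simp only: powr2)
    then show ?thesis using n by (simp add: powr_add powr_half_sqrt powr_realpow)
  qed
  have ln2: "(ln (real n) powr (1 / 4))\<^sup>2 = sqrt (ln (real n))"
    using ln by (simp add: powr2 powr_half_sqrt)
  have m2: "(real n powr (real l / 2 - real q))\<^sup>2 = real n ^ l / real n ^ (2 * q)"
  proof -
    have "2 * (real l / 2 - real q) = real l - real (2 * q)" by simp
    then have "(real n powr (real l / 2 - real q))\<^sup>2 = real n powr (real l - real (2 * q))"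
      by (simp only: powr2)
    then show ?thesis using n by (simp only: powr_diff powr_realpow)
  qed
  have B2: "B\<^sup>2 = sqrt (real l * ln (real n) * real n) * real n ^ q / real l ^ q"
    by (simp add: B_def power_mult_distrib l2 n2 ln2 real_sqrt_mult mult_ac)
  have \<tau>0: "\<tau> \<ge> 0" unfolding \<tau>_def using ln by simp
  have "(real n powr (real l / 2 - real q) * sqrt \<tau>)\<^sup>2 = real n ^ l / real n ^ (2 * q) * \<tau>"
    using \<tau>0 by (simp add: power_mult_distrib m2)
  also have "\<dots> = 300 * real (2 * q) ^ (3 * q) * B\<^sup>2"
  proof -
    have "real n ^ (3 * q) = real n ^ q * real n ^ (2 * q)"
      by (simp flip: power_add)
    then show ?thesis using n l by (simp add: \<tau>_def B2)
  qed
  also have "\<dots> \<le> (64 * real p ^ (2 * p)) * B\<^sup>2"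
  proof (rule mult_right_mono)
    have "real (2 * q) ^ (3 * q) \<le> real p ^ (3 * q)"
      using p by (intro power_mono) auto
    \<comment> \<open>The exponent 2p = 4q + 2 is split as 3q and q + 2, and p \<ge> 3 with q \<ge>
      1 gives 64 p^(q + 2) \<ge> 64 times 27.\<close>
    moreover have "300 \<le> 64 * real p ^ (q + 2)"
    proof -
      have "(3 :: real) ^ 3 \<le> real p ^ 3" using p q by (intro power_mono) auto
      also have "\<dots> \<le> real p ^ (q + 2)" using p q by (intro power_increasing) auto
      finally show ?thesis by simp
    qed
    ultimately have "300 * real (2 * q) ^ (3 * q) \<le> (64 * real p ^ (q + 2)) * real p ^ (3 * q)"
      by (intro mult_mono) auto
    also have "\<dots> = 64 * real p ^ (2 * p)"
      by (simp add: p flip: power_add)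
    finally show "300 * real (2 * q) ^ (3 * q) \<le> 64 * real p ^ (2 * p)" .
  qed simp
  also have "\<dots> = (8 * real p ^ p * B)\<^sup>2"
    by (simp add: power_mult_distrib power_mult[symmetric] mult.commute[of p])
  finally have "real n powr (real l / 2 - real q) * sqrt \<tau> \<le> 8 * real p ^ p * B"
    by (rule power2_le_imp_le) (simp add: B_def)
  then show ?thesis by (simp add: B_def mult.assoc)
qed

theorem theorem7:
  fixes n p q l :: nat
  assumes "p \<ge> 3" and "odd p" and "p = 2 * q + 1"
    and "p - 1 \<le> l"
    and "l + (p - 1) \<le> n"
    and "real l \<le> real n / (4 * real (p - 1))"
    and "real l \<le> real n / (8 * ln (real n))"
  shows "(\<forall>Y\<in>rad_tensors n p.
            rad_inj_norm n p Y \<le> sqrt (real n)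
              + real n powr (real l / 2 - real q) * sqrt (op_norm (tuples n l) (Mmat n q l Y)))
       \<and> measure_pmf.prob (pmf_of_set (rad_tensors n p))
           {Y. sqrt (real n) + real n powr (real l / 2 - real q) * sqrt (op_norm (tuples n l) (Mmat n q l Y))
               \<le> sqrt (real n) + 8 * real p ^ p * real l powr (1 / 2 - real p / 4)
                   * real n powr (real p / 4) * ln (real n) powr (1 / 4)}
         \<ge> 1 - 1 / real n ^ l"
proof -
  have q: "q > 0" and l: "2 * q \<le> l" and n1: "real l \<le> real n / (4 * real (2 * q))"
    and n: "n > 1" "real l \<ge> 1"
    using assms by auto
  have N: "Ncount n l a b c d > 0"
    if "a \<in> tuples n q" "b \<in> tuples n q" "c \<in> tuples n q" "d \<in> tuples n q" for a b c d
  proof -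
    have "0 < (real l / real (2 * q)) ^ (2 * q) * real n ^ (l - 2 * q) / 2" using q n by simp
    also have "\<dots> \<le> real (Ncount n l a b c d)" using Ncount_ge_real[OF q l n1 that] .
    finally show ?thesis by simp
  qed
  define \<tau> where "\<tau> = 300 * real (2 * q) ^ (3 * q) * sqrt (real l * ln (real n) * real n) * real n ^ (3 * q)
                / (real l ^ q * real n ^ l)"
  let ?good = "{Y. sqrt (real n) + real n powr (real l / 2 - real q) * sqrt (op_norm (tuples n l) (Mmat n q l Y))
               \<le> sqrt (real n) + 8 * real p ^ p * real l powr (1 / 2 - real p / 4)
                   * real n powr (real p / 4) * ln (real n) powr (1 / 4)}"
  \<comment> \<open>The certified quantity increases with the operator norm, so the claim about
    probability reduces to a deterministic comparison at \<open>\<tau>\<close>.\<close>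
  have "{Y. op_norm (tuples n l) (Mmat n q l Y) \<le> \<tau>} \<subseteq> ?good"
  proof clarify
    fix Y assume "op_norm (tuples n l) (Mmat n q l Y) \<le> \<tau>"
    then have "real n powr (real l / 2 - real q) * sqrt (op_norm (tuples n l) (Mmat n q l Y))
        \<le> real n powr (real l / 2 - real q) * sqrt \<tau>"
      by (intro mult_left_mono) auto
    also note certificate_bound[OF q n(2) _ assms(3), of n, folded \<tau>_def]
    finally show "sqrt (real n) + real n powr (real l / 2 - real q) * sqrt (op_norm (tuples n l) (Mmat n q l Y))
               \<le> sqrt (real n) + 8 * real p ^ p * real l powr (1 / 2 - real p / 4)
                   * real n powr (real p / 4) * ln (real n) powr (1 / 4)"
      using n by simp
  qed
  then have "measure_pmf.prob (pmf_of_set (rad_tensors n p)) {Y. op_norm (tuples n l) (Mmat n q l Y) \<le> \<tau>}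
      \<le> measure_pmf.prob (pmf_of_set (rad_tensors n p)) ?good"
    by (intro measure_pmf.finite_measure_mono) auto
  moreover note prob_op_norm_Mmat[OF q l n1 assms(7) \<tau>_def]
  ultimately show ?thesis
    using rad_inj_norm_le[OF _ _ l N] n assms(3) by (intro conjI ballI) auto
qed

end
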